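(* There is an algorithm which, given a connected graph $G$ with $n$ vertices and at least one edge, solves the minimum weighting ratio problem $\inf_{\omega\in W} t_\omega(G)$ in time polynomial in $n$.
   Context: Graphs are finite, simple and undirected. Let $W$ be the set of functions $\omega:E(G)\to\mathbb{R}_{\ge 0}$ that are not identically zero. For $\omega\in W$ let $\omega(H)=\sum_{e\in E(H)}\omega(e)$ for a subgraph $H$, and $\omega(G)=\sum_{e\in E(G)}\omega(e)$. Let $T_\omega$ be a maximum spanning tree of $G$ with respect to $\omega$, i.e. a spanning tree maximizing $\omega(T)$. The weighting ratio is $t_\omega(G)=\omega(T_\omega)/\omega(G)$. The minimum weighting ratio problem asks for $\inf_{\omega\in W}t_\omega(G)$ together with an edge-weight function attaining it. *)

theory Defs
  imports Complex_Main "HOL-Computational_Algebra.Polynomial"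
begin

section \<open>Finite simple graphs and spanning trees\<close>

text \<open>A graph is given by its vertex set and its set of two-element edges.\<close>

definition simple_graph :: "'a set \<Rightarrow> 'a set set \<Rightarrow> bool" where
  "simple_graph V E \<longleftrightarrow> finite V \<and> (\<forall>e\<in>E. \<exists>u\<in>V. \<exists>v\<in>V. u \<noteq> v \<and> e = {u, v})"

definition graph_connected :: "'a set \<Rightarrow> 'a set set \<Rightarrow> bool" where
  "graph_connected V E \<longleftrightarrow>
     V \<noteq> {} \<and> (\<forall>u\<in>V. \<forall>v\<in>V. (u, v) \<in> {(x, y). {x, y} \<in> E}\<^sup>*)"

definition graph_cycle :: "'a set set \<Rightarrow> 'a list \<Rightarrow> bool" where
  "graph_cycle E vs \<longleftrightarrow> distinct vs \<and> 3 \<le> length vs \<and>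
     (\<forall>i<length vs. {vs ! i, vs ! (Suc i mod length vs)} \<in> E)"

definition graph_tree :: "'a set \<Rightarrow> 'a set set \<Rightarrow> bool" where
  "graph_tree V T \<longleftrightarrow> simple_graph V T \<and> graph_connected V T \<and> (\<nexists>vs. graph_cycle T vs)"

definition spanning_tree_of :: "'a set \<Rightarrow> 'a set set \<Rightarrow> 'a set set \<Rightarrow> bool" where
  "spanning_tree_of V E T \<longleftrightarrow> T \<subseteq> E \<and> graph_tree V T"

section \<open>The minimum weighting ratio\<close>

text \<open>Only the values of a weighting on \<open>E\<close> are relevant.\<close>

definition weightings :: "'a set set \<Rightarrow> ('a set \<Rightarrow> real) set" where
  "weightings E = {\<omega>. (\<forall>e\<in>E. 0 \<le> \<omega> e) \<and> (\<exists>e\<in>E. \<omega> e \<noteq> 0)}"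

definition max_spanning_tree :: "'a set \<Rightarrow> 'a set set \<Rightarrow> ('a set \<Rightarrow> real) \<Rightarrow> 'a set set" where
  "max_spanning_tree V E \<omega> = arg_max (\<lambda>T. \<Sum>e\<in>T. \<omega> e) (spanning_tree_of V E)"

definition weighting_ratio :: "'a set \<Rightarrow> 'a set set \<Rightarrow> ('a set \<Rightarrow> real) \<Rightarrow> real" where
  "weighting_ratio V E \<omega> = (\<Sum>e\<in>max_spanning_tree V E \<omega>. \<omega> e) / (\<Sum>e\<in>E. \<omega> e)"

definition min_weighting_ratio :: "'a set \<Rightarrow> 'a set set \<Rightarrow> real" where
  "min_weighting_ratio V E = (INF \<omega>\<in>weightings E. weighting_ratio V E \<omega>)"

section \<open>The model of computation\<close>

text \<open>
  Structured programs for a random access machine. The memory consists of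
  arrays of natural numbers, of which a program mentions only finitely many;
  a scalar is cell 0 of an array. Evaluating each node of an expression costs one step.
  Since addition and truncated subtraction are the only arithmetic operations, the bit length
  of the numbers grows by at most a constant per step, so that polynomial
  running time in this unit-cost model agrees with polynomial time on Turing
  machines. (This would fail if multiplication were a primitive.)
\<close>

type_synonym vname = string
type_synonym state = "vname \<Rightarrow> nat \<Rightarrow> nat"

datatype aexp = Lit nat | Cell vname aexp | Add aexp aexp | Monus aexp aexp

datatype bexp = Less aexp aexp | Neg bexp | Conj bexp bexp

datatype com =
    Skip
  | Assign vname aexp aexp
  | Seq com com
  | Cond bexp com com
  | While bexp com

fun aval :: "aexp \<Rightarrow> state \<Rightarrow> nat" where
  "aval (Lit k) s = k"
| "aval (Cell x i) s = s x (aval i s)"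
| "aval (Add a b) s = aval a s + aval b s"
| "aval (Monus a b) s = aval a s - aval b s"

fun acost :: "aexp \<Rightarrow> nat" where
  "acost (Lit k) = 1"
| "acost (Cell x i) = 1 + acost i"
| "acost (Add a b) = 1 + acost a + acost b"
| "acost (Monus a b) = 1 + acost a + acost b"

fun bval :: "bexp \<Rightarrow> state \<Rightarrow> bool" where
  "bval (Less a b) s \<longleftrightarrow> aval a s < aval b s"
| "bval (Neg b) s \<longleftrightarrow> \<not> bval b s"
| "bval (Conj a b) s \<longleftrightarrow> bval a s \<and> bval b s"

fun bcost :: "bexp \<Rightarrow> nat" where
  "bcost (Less a b) = 1 + acost a + acost b"
| "bcost (Neg b) = 1 + bcost b"
| "bcost (Conj a b) = 1 + bcost a + bcost b"

text \<open>
  \<open>exec c s t s'\<close>: started in state \<open>s\<close>, program \<open>c\<close> terminates after \<open>t\<close> steps in state \<open>s'\<close>.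
\<close>

inductive exec :: "com \<Rightarrow> state \<Rightarrow> nat \<Rightarrow> state \<Rightarrow> bool" where
  exec_Skip: "exec Skip s 1 s"
| exec_Assign: "exec (Assign x i a) s (1 + acost i + acost a)
    (s(x := (s x)(aval i s := aval a s)))"
| exec_Seq: "exec c1 s1 t1 s2 \<Longrightarrow> exec c2 s2 t2 s3 \<Longrightarrow> exec (Seq c1 c2) s1 (t1 + t2) s3"
| exec_CondTrue: "bval b s \<Longrightarrow> exec c1 s t s' \<Longrightarrow> exec (Cond b c1 c2) s (1 + bcost b + t) s'"
| exec_CondFalse: "\<not> bval b s \<Longrightarrow> exec c2 s t s' \<Longrightarrow> exec (Cond b c1 c2) s (1 + bcost b + t) s'"
| exec_WhileFalse: "\<not> bval b s \<Longrightarrow> exec (While b c) s (1 + bcost b) s"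
| exec_WhileTrue: "bval b s1 \<Longrightarrow> exec c s1 t1 s2 \<Longrightarrow> exec (While b c) s2 t2 s3
    \<Longrightarrow> exec (While b c) s1 (1 + bcost b + t1 + t2) s3"

inductive_cases SkipE: "exec Skip s t s'"
inductive_cases AssignE: "exec (Assign x i a) s t s'"
inductive_cases SeqE: "exec (Seq c1 c2) s t s'"
inductive_cases CondE: "exec (Cond b c1 c2) s t s'"
inductive_cases WhileE: "exec (While b c) s t s'"

lemma exec_deterministic:
  "exec c s t s' \<Longrightarrow> exec c s u s'' \<Longrightarrow> t = u \<and> s' = s''"
proof (induction arbitrary: u s'' rule: exec.induct)
  case (exec_WhileTrue b s1 c t1 s2 t2 s3)
  from exec_WhileTrue.prems obtain v1 r v2
    where "exec c s1 v1 r" "exec (While b c) r v2 s''" "u = 1 + bcost b + v1 + v2"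
    by (rule WhileE) (use exec_WhileTrue.hyps(1) in auto)
  then show ?case using exec_WhileTrue.IH by blast
next
  case (exec_Seq c1 s1 t1 s2 c2 t2 s3)
  from exec_Seq.prems obtain v1 r v2
    where "exec c1 s1 v1 r" "exec c2 r v2 s''" "u = v1 + v2"
    by (rule SeqE) auto
  then show ?case using exec_Seq.IH by blast
next
  case (exec_Skip s)
  then show ?case by (rule SkipE) simp
next
  case (exec_Assign x i a s)
  then show ?case by (rule AssignE) simp
next
  case (exec_CondTrue b s c1 t s' c2)
  from exec_CondTrue.prems obtain v where "exec c1 s v s''" "u = 1 + bcost b + v"
    by (rule CondE) (use exec_CondTrue.hyps(1) in auto)
  then show ?case using exec_CondTrue.IH by blast
next
  case (exec_CondFalse b s c2 t s' c1)
  from exec_CondFalse.prems obtain v where "exec c2 s v s''" "u = 1 + bcost b + v"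
    by (rule CondE) (use exec_CondFalse.hyps(1) in auto)
  then show ?case using exec_CondFalse.IH by blast
next
  case (exec_WhileFalse b s c)
  from exec_WhileFalse.prems show ?case
    by (rule WhileE) (use exec_WhileFalse.hyps in simp_all)
qed

section \<open>Input and output conventions\<close>

text \<open>
  A graph on the vertices \<open>0, \<dots>, n - 1\<close> is presented by \<open>n\<close> and a list of its
  edges, each edge occurring once, with its endpoints in either order.
\<close>

definition edge_listing :: "(nat \<times> nat) list \<Rightarrow> nat set set \<Rightarrow> bool" where
  "edge_listing es E \<longleftrightarrow>
     distinct (map (\<lambda>(u, v). {u, v}) es) \<and> set (map (\<lambda>(u, v). {u, v}) es) = E"

definition input_state :: "nat \<Rightarrow> (nat \<times> nat) list \<Rightarrow> state" where
  "input_state n es = (\<lambda>x i.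
     if x = ''n'' \<and> i = 0 then n
     else if x = ''m'' \<and> i = 0 then length es
     else if x = ''src'' \<and> i < length es then fst (es ! i)
     else if x = ''dst'' \<and> i < length es then snd (es ! i)
     else 0)"

text \<open>
  The output is the infimum, as a fraction, and an optimal weighting, as one
  fraction for each edge of the input list.
\<close>

definition solves_min_weighting_ratio ::
    "nat set \<Rightarrow> nat set set \<Rightarrow> (nat \<times> nat) list \<Rightarrow> state \<Rightarrow> bool" where
  "solves_min_weighting_ratio V E es s \<longleftrightarrow>
     s ''den'' 0 > 0 \<and>
     real (s ''num'' 0) / real (s ''den'' 0) = min_weighting_ratio V E \<and>
     (\<exists>\<omega>\<in>weightings E.
        weighting_ratio V E \<omega> = min_weighting_ratio V E \<and>
        (\<forall>k<length es. s ''wden'' k > 0 \<and>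
           \<omega> {fst (es ! k), snd (es ! k)} = real (s ''wnum'' k) / real (s ''wden'' k)))"

end

theory Submission
  imports Defs "HOL-Library.Indicator_Function" "HOL-Library.Transitive_Closure_Table"
begin

text \<open>
  Maintain a family of \<open>K = m\<^sup>3\<close> connected spanning edge sets, where \<open>m\<close> is the number of edges,
  and let the load of an edge be the number of members containing it. As long as possible, replace
  some member \<open>T\<close> by \<open>T + f - e\<close>, provided this is still connected and either \<open>f = e\<close> or the load of
  \<open>f\<close> is smaller than that of \<open>e\<close> by at least 2. Each move decreases the sum of the squared loads, so
  this stops after polynomially many moves, and then all members are spanning trees.

  Averaging over the family, every weighting has ratio at least \<open>l / K\<close>, where \<open>l\<close> is the minimum
  load. Conversely, \<open>m\<close> edges cannot occupy all the loads \<open>l, \<dots>, l + m\<close>, so for some \<open>j\<close> with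
  \<open>l \<le> j < l + m\<close> there is no edge of load \<open>j + 1\<close>. Then no single exchange can increase the
  intersection of a member with the set \<open>L\<close> of edges of load at most \<open>j\<close>. By the exchange property of
  the graphic matroid every member is a maximum spanning tree for the indicator of \<open>L\<close>, whose ratio is
  therefore at most \<open>j / K \<le> (l + m - 1) / K\<close>. Letting \<open>K\<close> tend to infinity shows that the infimum is
  attained by an indicator, so it is a fraction with denominator at most \<open>m\<close>; as two different such
  fractions are at least \<open>1 / m\<^sup>2\<close> apart, \<open>K = m\<^sup>3\<close> makes the indicator of \<open>L\<close> exactly optimal.
\<close>

section \<open>Closure operators with the exchange property\<close>

locale exchange_closure =
  fixes span :: "'a set \<Rightarrow> 'a set"
  assumes subset_span: "A \<subseteq> span A"
    and span_minimal: "A \<subseteq> span B \<Longrightarrow> span A \<subseteq> span B"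
    and exchange: "f \<in> span (insert e A) \<Longrightarrow> f \<notin> span A \<Longrightarrow> e \<in> span (insert f A)"
begin

definition independent :: "'a set \<Rightarrow> bool" where
  "independent A \<longleftrightarrow> (\<forall>e\<in>A. e \<notin> span (A - {e}))"

lemma span_mono: "A \<subseteq> B \<Longrightarrow> span A \<subseteq> span B"
  using span_minimal subset_span by blast

lemma subset_span_if_Diff_subset: "e \<in> span A \<Longrightarrow> B - {e} \<subseteq> A \<Longrightarrow> B \<subseteq> span A"
  using subset_span[of A] by blast

lemma independent_mono: "independent B \<Longrightarrow> A \<subseteq> B \<Longrightarrow> independent A"
  unfolding independent_def by (meson Diff_mono order_refl span_mono subsetD)

lemma independent_insert:
  assumes "independent A" "b \<notin> span A"
  shows "independent (insert b A)"
  unfolding independent_def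
proof
  fix e assume "e \<in> insert b A"
  have "b \<notin> A" using assms(2) subset_span[of A] by blast
  show "e \<notin> span (insert b A - {e})"
  proof (cases "e = b")
    case True
    then show ?thesis using assms(2) \<open>b \<notin> A\<close> by simp
  next
    case False
    then have "e \<in> A" and "insert b A - {e} = insert b (A - {e})" using \<open>e \<in> insert b A\<close> by auto
    moreover have "e \<notin> span (A - {e})" using assms(1) \<open>e \<in> A\<close> by (simp add: independent_def)
    ultimately show ?thesis
      using exchange[of e b "A - {e}"] assms(2) by (auto simp: insert_absorb)
  qed
qed

lemma independent_exchange:
  assumes "independent F" "f \<in> F" "F \<subseteq> span B"
  obtains b where "b \<in> B" "b \<notin> span (F - {f})" "independent (insert b (F - {f}))"
proof -
  have "f \<notin> span (F - {f})" using assms(1,2) by (simp add: independent_def)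
  then have "\<not> B \<subseteq> span (F - {f})" using span_minimal assms(2,3) by blast
  then obtain b where "b \<in> B" "b \<notin> span (F - {f})" by blast
  moreover have "independent (F - {f})" using assms(1) independent_mono by blast
  ultimately show ?thesis using that independent_insert by blast
qed

lemma independent_card_le:
  assumes "finite B" "finite F" "independent F" "F \<subseteq> span B"
  shows "card F \<le> card B"
  using assms(2-)
proof (induction "card (F - B)" arbitrary: F rule: less_induct)
  case less
  show ?case
  proof (cases "F \<subseteq> B")
    case True
    then show ?thesis using assms(1) by (simp add: card_mono)
  next
    case False
    then obtain f where removed: "f \<in> F" "f \<notin> B" by blast
    obtain b where added: "b \<in> B" "b \<notin> span (F - {f})" "independent (insert b (F - {f}))"
      by (rule independent_exchange[OF less.prems(2) removed(1) less.prems(3)])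
    let ?F = "insert b (F - {f})"
    have "?F - B = F - B - {f}" using added(1) by auto
    then have "card (?F - B) < card (F - B)"
      using less.prems(1) removed card_Diff1_less[of "F - B" f] by (simp del: card_Diff_singleton)
    moreover have "?F \<subseteq> span B" using less.prems(3) added(1) subset_span[of B] by blast
    moreover have "finite ?F" using less.prems(1) by simp
    ultimately have "card ?F \<le> card B" using less.hyps[of ?F] added(3) by simp
    have "b \<notin> F - {f}" using added(2) subset_span[of "F - {f}"] by blast
    then have "card ?F = card F"
      using less.prems(1) removed(1) card_Suc_Diff1[of F f] by (simp del: card_Diff_singleton)
    then show ?thesis using \<open>card ?F \<le> card B\<close> by simp
  qed
qed

lemma span_Int_if_no_exchange:
  assumes "finite T" "f \<in> span T"
    and no_exchange: "\<And>e. e \<in> T - L \<Longrightarrow> e \<notin> span (insert f (T - {e}))"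
  shows "f \<in> span (T \<inter> L)"
proof -
  have "f \<in> span (T \<inter> L)" if "finite S" "S \<subseteq> T - L" "f \<in> span (T \<inter> L \<union> S)" for S
    using that
  proof (induction S)
    case (insert e S)
    then have "insert f (T \<inter> L \<union> S) \<subseteq> insert f (T - {e})" by blast
    then have "e \<notin> span (insert f (T \<inter> L \<union> S))"
      using no_exchange[of e] span_mono insert.prems by blast
    then have "f \<in> span (T \<inter> L \<union> S)"
      using exchange[of f e "T \<inter> L \<union> S"] insert.prems by auto
    then show ?case using insert by blast
  qed simp
  from this[of "T - L"] show ?thesis using assms(1,2) by (simp add: Int_Diff_Un)
qed

lemma card_Int_le_if_no_exchange:
  assumes "finite T" "finite T'" "independent T'" "T' \<subseteq> span T"
    and "\<And>e f. e \<in> T - L \<Longrightarrow> f \<in> L \<Longrightarrow> e \<notin> span (insert f (T - {e}))"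
  shows "card (T' \<inter> L) \<le> card (T \<inter> L)"
proof (rule independent_card_le)
  show "T' \<inter> L \<subseteq> span (T \<inter> L)" using assms span_Int_if_no_exchange[of T] by blast
  show "independent (T' \<inter> L)" using assms(3) by (rule independent_mono) blast
qed (use assms in auto)

end

section \<open>Connectivity and spanning trees\<close>

abbreviation reachable :: "'a set set \<Rightarrow> 'a \<Rightarrow> 'a \<Rightarrow> bool" where
  "reachable E \<equiv> (\<lambda>x y. {x, y} \<in> E)\<^sup>*\<^sup>*"

lemma graph_connected_iff_reachable:
  "graph_connected V E \<longleftrightarrow> V \<noteq> {} \<and> (\<forall>u\<in>V. \<forall>v\<in>V. reachable E u v)"
  by (simp add: graph_connected_def rtranclp_rtrancl_eq)

lemma reachable_sym: "reachable E x y \<Longrightarrow> reachable E y x"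
  by (rule sympD[OF symp_rtranclp]) (simp_all add: symp_def insert_commute)

lemma reachable_invariant:
  assumes "reachable E x y" "\<And>a b. {a, b} \<in> E \<Longrightarrow> c a = c b"
  shows "c x = c y"
  using assms by (induction rule: rtranclp_induct) auto

lemma reachable_insertE:
  assumes "reachable (insert {u, v} E) x y"
  obtains "reachable E x y"
    | "reachable E x u" "reachable E v y"
    | "reachable E x v" "reachable E u y"
proof -
  from assms have "reachable E x y \<or> reachable E x u \<and> reachable E v y \<or>
      reachable E x v \<and> reachable E u y"
  proof (induction rule: rtranclp_induct)
    case (step y z)
    show ?case
    proof (cases "{y, z} = {u, v}")
      case True
      then have "y = u \<and> z = v \<or> y = v \<and> z = u" by (auto simp: doubleton_eq_iff)
      then show ?thesis using step.IH by auto
    next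
      case False
      then have "{y, z} \<in> E" using step.hyps by simp
      then show ?thesis using step.IH by (auto intro: rtranclp.rtrancl_into_rtrancl)
    qed
  qed simp
  then show ?thesis using that by blast
qed

text \<open>Members that are not pairs of vertices act as loops, so that \<open>A \<subseteq> edge_span A\<close> for every \<open>A\<close>.\<close>

definition edge_span :: "'a set set \<Rightarrow> 'a set set" where
  "edge_span A = {e. \<forall>u v. e = {u, v} \<longrightarrow> reachable A u v}"

lemma edge_in_edge_span_iff: "{u, v} \<in> edge_span A \<longleftrightarrow> reachable A u v"
  using reachable_sym[of A] by (auto simp: edge_span_def doubleton_eq_iff)

lemma reachable_if_subset_edge_span:
  assumes "A \<subseteq> edge_span B" "reachable A x y"
  shows "reachable B x y"
  using assms(2)
proof (induction rule: rtranclp_induct)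
  case (step y z)
  then have "{y, z} \<in> edge_span B" using assms(1) by blast
  then show ?case using step.IH by (simp add: edge_in_edge_span_iff)
qed simp

interpretation edges: exchange_closure edge_span
proof
  show "A \<subseteq> edge_span A" for A :: "'a set set"
    by (auto simp: edge_span_def)
  show "edge_span A \<subseteq> edge_span B" if "A \<subseteq> edge_span B" for A B :: "'a set set"
    using reachable_if_subset_edge_span[OF that] by (auto simp: edge_span_def)
  show "e \<in> edge_span (insert f A)"
    if dependent: "f \<in> edge_span (insert e A)" "f \<notin> edge_span A" for e f :: "'a set" and A
    unfolding edge_span_def
  proof (intro CollectI allI impI)
    fix x y assume e_eq: "e = {x, y}"
    obtain u v where ends: "f = {u, v}" "\<not> reachable A u v"
      using dependent(2) by (auto simp: edge_span_def)
    then have "reachable (insert {x, y} A) u v"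
      using dependent(1) e_eq by (simp add: edge_in_edge_span_iff)
    then consider "reachable A u x" "reachable A y v" | "reachable A u y" "reachable A x v"
      by (rule reachable_insertE) (use ends in auto)
    then have "reachable A x u \<and> reachable A v y \<or> reachable A x v \<and> reachable A u y"
      by cases (auto intro: reachable_sym)
    moreover have "reachable (insert f A) p q" if "reachable A p q" for p q
      using that by (rule rtranclp_mono[THEN predicate2D, rotated]) auto
    moreover have "reachable (insert f A) u v" "reachable (insert f A) v u"
      using ends by (auto simp: insert_commute)
    ultimately show "reachable (insert f A) x y" by (meson rtranclp_trans)
  qed
qed

lemma graph_connected_if_subset_edge_span:
  "graph_connected V A \<Longrightarrow> A \<subseteq> edge_span B \<Longrightarrow> graph_connected V B"
  using reachable_if_subset_edge_span[of A B] by (simp add: graph_connected_iff_reachable)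

lemma simple_graph_subset_edge_span:
  assumes "simple_graph V E" "graph_connected V T"
  shows "E \<subseteq> edge_span T"
proof
  fix e assume "e \<in> E"
  then obtain u v where "u \<in> V" "v \<in> V" "e = {u, v}" using assms(1) by (auto simp: simple_graph_def)
  then show "e \<in> edge_span T"
    using assms(2) by (simp add: edge_in_edge_span_iff graph_connected_iff_reachable)
qed

lemma graph_connected_iff_closed_set:
  assumes "r \<in> S" "S \<subseteq> V" "\<And>v. v \<in> S \<Longrightarrow> reachable E r v"
    and closed: "\<And>a b. {a, b} \<in> E \<Longrightarrow> a \<in> S \<longleftrightarrow> b \<in> S"
  shows "graph_connected V E \<longleftrightarrow> S = V"
proof
  assume "graph_connected V E"
  then have "r \<in> S \<longleftrightarrow> v \<in> S" if "v \<in> V" for v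
    using that assms(1,2) closed reachable_invariant[of E r v "\<lambda>x. x \<in> S"]
    by (auto simp: graph_connected_iff_reachable)
  then show "S = V" using assms(1,2) by blast
next
  assume "S = V"
  then show "graph_connected V E"
    using assms(1,3) unfolding graph_connected_iff_reachable
    by (blast intro: reachable_sym rtranclp_trans)
qed

lemma graph_cycle_edge_redundant:
  assumes "graph_cycle T vs"
  obtains e where "e \<in> T" "e \<in> edge_span (T - {e})"
proof -
  let ?l = "length vs"
  have "distinct vs" and len: "3 \<le> ?l" and edge: "\<And>i. i < ?l \<Longrightarrow> {vs ! i, vs ! (Suc i mod ?l)} \<in> T"
    using assms by (auto simp: graph_cycle_def)
  then have nth_eq: "vs ! i = vs ! j \<longleftrightarrow> i = j" if "i < ?l" "j < ?l" for i j
    using that by (simp add: nth_eq_iff_index_eq)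
  define e where "e = {vs ! 0, vs ! (?l - 1)}"
  have "reachable (T - {e}) (vs ! 0) (vs ! i)" if "i < ?l" for i
    using that
  proof (induction i)
    case (Suc i)
    have "{vs ! i, vs ! Suc i} \<noteq> e"
      using Suc.prems len nth_eq[of i 0] nth_eq[of i "?l - 1"] nth_eq[of "Suc i" "?l - 1"]
      unfolding e_def doubleton_eq_iff by linarith
    moreover have "{vs ! i, vs ! Suc i} \<in> T" using edge[of i] Suc.prems by simp
    ultimately show ?case using Suc by (auto intro: rtranclp.rtrancl_into_rtrancl)
  qed simp
  then have "e \<in> edge_span (T - {e})" using len by (simp add: edge_in_edge_span_iff e_def)
  moreover have "e \<in> T"
    using edge[of "?l - 1"] len Suc_diff_1[of ?l] by (fastforce simp: e_def insert_commute)
  ultimately show ?thesis using that by blast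
qed

lemma graph_cycle_if_redundant_edge:
  assumes "{u, v} \<in> T" "u \<noteq> v" "{u, v} \<in> edge_span (T - {{u, v}})"
  shows "\<exists>vs. graph_cycle T vs"
proof -
  let ?adj = "\<lambda>x y. {x, y} \<in> T - {{u, v}}"
  obtain xs where "rtrancl_path ?adj u xs v"
    using assms(3) by (auto simp: edge_in_edge_span_iff rtranclp_eq_rtrancl_path)
  then obtain ys where path: "rtrancl_path ?adj u ys v" and "distinct (u # ys)"
    by (rule rtrancl_path_distinct)
  have edge: "{(u # ys) ! i, ys ! i} \<in> T - {{u, v}}" if "i < length ys" for i
    using rtrancl_path_nth[OF path that] .
  have "ys \<noteq> []" using path assms(2) by (auto elim: rtrancl_path.cases)
  then have last: "ys ! (length ys - 1) = v"
    using rtrancl_path_last[OF path] by (simp add: last_conv_nth)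
  moreover have "length ys \<noteq> 1" using edge[of 0] last \<open>ys \<noteq> []\<close> by auto
  ultimately have "2 \<le> length ys" using \<open>ys \<noteq> []\<close> by (cases ys) (auto simp: Suc_le_eq)
  have "{(u # ys) ! i, (u # ys) ! (Suc i mod length (u # ys))} \<in> T" if "i < length (u # ys)" for i
  proof (cases "i < length ys")
    case True
    then show ?thesis using edge by simp
  next
    case False
    then have "i = Suc (length ys - 1)" using that \<open>ys \<noteq> []\<close> by simp
    then show ?thesis using last assms(1) \<open>ys \<noteq> []\<close> by (simp add: insert_commute)
  qed
  then have "graph_cycle T (u # ys)"
    using \<open>distinct (u # ys)\<close> \<open>2 \<le> length ys\<close> by (simp add: graph_cycle_def)
  then show ?thesis ..
qed

lemma acyclic_iff_independent:
  assumes "simple_graph V T"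
  shows "(\<nexists>vs. graph_cycle T vs) \<longleftrightarrow> edges.independent T"
proof
  assume acyclic: "\<nexists>vs. graph_cycle T vs"
  show "edges.independent T"
    unfolding edges.independent_def
  proof
    fix e assume "e \<in> T"
    then obtain u v where "e = {u, v}" "u \<noteq> v" using assms by (auto simp: simple_graph_def)
    then show "e \<notin> edge_span (T - {e})"
      using acyclic graph_cycle_if_redundant_edge \<open>e \<in> T\<close> by metis
  qed
next
  assume "edges.independent T"
  then show "\<nexists>vs. graph_cycle T vs"
    by (auto simp: edges.independent_def elim: graph_cycle_edge_redundant)
qed

lemma graph_treeI_minimal:
  assumes "simple_graph V T" "graph_connected V T" "\<And>e. e \<in> T \<Longrightarrow> \<not> graph_connected V (T - {e})"
  shows "graph_tree V T"
proof -
  have "e \<notin> edge_span (T - {e})" if "e \<in> T" for e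
  proof
    assume "e \<in> edge_span (T - {e})"
    then have "T \<subseteq> edge_span (T - {e})" by (rule edges.subset_span_if_Diff_subset) simp
    with assms(2) have "graph_connected V (T - {e})" by (rule graph_connected_if_subset_edge_span)
    then show False using assms(3) that by blast
  qed
  then have "edges.independent T" by (simp add: edges.independent_def)
  then show ?thesis using assms(1,2) acyclic_iff_independent[of V T] by (simp add: graph_tree_def)
qed

lemma simple_graph_finite: "simple_graph V E \<Longrightarrow> finite E"
  by (rule finite_subset[of _ "Pow V"]) (auto simp: simple_graph_def)

lemma simple_graph_mono: "simple_graph V E \<Longrightarrow> T \<subseteq> E \<Longrightarrow> simple_graph V T"
  by (auto simp: simple_graph_def)

lemma graph_tree_card_Int_le:
  assumes tree: "graph_tree V T" and tree': "graph_tree V T'"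
    and no_exchange: "\<And>e f. e \<in> T - L \<Longrightarrow> f \<in> L \<Longrightarrow> \<not> graph_connected V (insert f (T - {e}))"
  shows "card (T' \<inter> L) \<le> card (T \<inter> L)"
proof (rule edges.card_Int_le_if_no_exchange)
  have trees: "simple_graph V T" "simple_graph V T'" "graph_connected V T"
    using tree tree' by (simp_all add: graph_tree_def)
  then show "finite T" "finite T'" "T' \<subseteq> edge_span T"
    by (simp_all add: simple_graph_finite simple_graph_subset_edge_span)
  show "edges.independent T'"
    using tree' trees(2) acyclic_iff_independent by (auto simp: graph_tree_def)
  show "e \<notin> edge_span (insert f (T - {e}))" if "e \<in> T - L" "f \<in> L" for e f
  proof
    assume "e \<in> edge_span (insert f (T - {e}))"
    then have "T \<subseteq> edge_span (insert f (T - {e}))" by (rule edges.subset_span_if_Diff_subset) blast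
    with trees(3) have "graph_connected V (insert f (T - {e}))"
      by (rule graph_connected_if_subset_edge_span)
    then show False using no_exchange[OF that] by blast
  qed
qed

lemma max_spanning_tree_is_max:
  assumes "finite E" "spanning_tree_of V E T"
  shows "spanning_tree_of V E (max_spanning_tree V E \<omega>)"
    and "sum \<omega> T \<le> sum \<omega> (max_spanning_tree V E \<omega>)"
proof -
  have "{T. spanning_tree_of V E T} \<subseteq> Pow E" by (auto simp: spanning_tree_of_def)
  then have "finite {T. spanning_tree_of V E T}" using assms(1) finite_subset by auto
  then have "finite (sum \<omega> ` {T. spanning_tree_of V E T})" by simp
  then obtain M where "is_arg_max (sum \<omega>) (spanning_tree_of V E) M"
    using finite_has_maximal2[of "sum \<omega> ` {T. spanning_tree_of V E T}" "sum \<omega> T"] assms(2)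
    by (auto simp: is_arg_max_def order.strict_iff_order)
  then have "is_arg_max (sum \<omega>) (spanning_tree_of V E) (max_spanning_tree V E \<omega>)"
    unfolding max_spanning_tree_def arg_max_def by (rule someI)
  then show "spanning_tree_of V E (max_spanning_tree V E \<omega>)"
    and "sum \<omega> T \<le> sum \<omega> (max_spanning_tree V E \<omega>)"
    using assms(2) by (auto simp: is_arg_max_linorder)
qed

section \<open>Locally optimal families of spanning trees\<close>

definition load :: "nat \<Rightarrow> (nat \<Rightarrow> 'e set) \<Rightarrow> 'e \<Rightarrow> nat" where
  "load K Tr e = card {i. i < K \<and> e \<in> Tr i}"

definition exchange_at :: "nat \<Rightarrow> 'e \<Rightarrow> 'e \<Rightarrow> (nat \<Rightarrow> 'e set) \<Rightarrow> nat \<Rightarrow> 'e set" where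
  "exchange_at i e f Tr = Tr(i := insert f (Tr i) - {e})"

definition connected_family :: "'a set \<Rightarrow> 'a set set \<Rightarrow> nat \<Rightarrow> (nat \<Rightarrow> 'a set set) \<Rightarrow> bool" where
  "connected_family V E K Tr \<longleftrightarrow> (\<forall>i<K. Tr i \<subseteq> E \<and> graph_connected V (Tr i))"

text \<open>Taking \<open>f = e\<close> removes the edge \<open>e\<close>.\<close>

definition improving :: "'a set \<Rightarrow> nat \<Rightarrow> (nat \<Rightarrow> 'a set set) \<Rightarrow> nat \<Rightarrow> 'a set \<Rightarrow> 'a set \<Rightarrow> bool" where
  "improving V K Tr i e f \<longleftrightarrow> e \<in> Tr i \<and> (f = e \<or> load K Tr f + 2 \<le> load K Tr e) \<and>
     graph_connected V (insert f (Tr i) - {e})"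

definition locally_optimal :: "'a set \<Rightarrow> 'a set set \<Rightarrow> nat \<Rightarrow> (nat \<Rightarrow> 'a set set) \<Rightarrow> bool" where
  "locally_optimal V E K Tr \<longleftrightarrow>
     connected_family V E K Tr \<and> (\<forall>i<K. \<forall>e\<in>E. \<forall>f\<in>E. \<not> improving V K Tr i e f)"

definition potential :: "'e set \<Rightarrow> nat \<Rightarrow> (nat \<Rightarrow> 'e set) \<Rightarrow> nat" where
  "potential E K Tr = (\<Sum>e\<in>E. (load K Tr e)\<^sup>2)"

lemma load_eq_sum: "load K Tr e = (\<Sum>i<K. of_bool (e \<in> Tr i))"
  by (simp add: load_def sum_of_bool_eq Int_def)

lemma load_le: "load K Tr e \<le> K"
  using card_mono[of "{..<K}" "{i. i < K \<and> e \<in> Tr i}"] by (auto simp: load_def)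

lemma load_fun_upd:
  "i < K \<Longrightarrow> load K (Tr(i := T)) e + of_bool (e \<in> Tr i) = load K Tr e + of_bool (e \<in> T)"
  by (simp add: load_eq_sum sum.remove[of "{..<K}" i] del: sum_of_bool_eq)

lemma sum_Int_family:
  fixes \<omega> :: "'e \<Rightarrow> 'b :: comm_semiring_1"
  assumes "finite F"
  shows "(\<Sum>i<K. sum \<omega> (Tr i \<inter> F)) = (\<Sum>e\<in>F. of_nat (load K Tr e) * \<omega> e)"
proof -
  have "sum \<omega> (Tr i \<inter> F) = (\<Sum>e\<in>F. of_bool (e \<in> Tr i) * \<omega> e)" for i
    unfolding Int_commute[of _ F] sum.inter_restrict[OF assms] by (intro sum.cong) auto
  then have "(\<Sum>i<K. sum \<omega> (Tr i \<inter> F)) = (\<Sum>i<K. \<Sum>e\<in>F. of_bool (e \<in> Tr i) * \<omega> e)"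
    by simp
  also have "\<dots> = (\<Sum>e\<in>F. (\<Sum>i<K. of_bool (e \<in> Tr i)) * \<omega> e)"
    by (subst sum.swap) (simp add: sum_distrib_right del: sum_of_bool_eq)
  finally show ?thesis by (simp add: load_eq_sum of_nat_sum del: sum_of_bool_eq)
qed

lemma sum_squares_less_if_balanced:
  fixes a b :: "'e \<Rightarrow> nat"
  assumes members: "finite E" "e \<in> E" "f \<in> E" and "b e < a e"
    and balanced: "f \<noteq> e \<Longrightarrow> b f \<le> a f + 1 \<and> a f + 2 \<le> a e"
    and "\<And>g. g \<noteq> e \<Longrightarrow> g \<noteq> f \<Longrightarrow> b g = a g"
  shows "(\<Sum>g\<in>E. (b g)\<^sup>2) < (\<Sum>g\<in>E. (a g)\<^sup>2)"
proof -
  have rest: "(\<Sum>g\<in>E - {e} - {f}. (b g)\<^sup>2) = (\<Sum>g\<in>E - {e} - {f}. (a g)\<^sup>2)"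
    using assms(6) by (intro sum.cong) auto
  show ?thesis
  proof (cases "f = e")
    case True
    have "(b e)\<^sup>2 < (a e)\<^sup>2" using \<open>b e < a e\<close> by (intro power_strict_mono) auto
    then show ?thesis using members(1,2) rest True by (simp add: sum.remove[of E e])
  next
    case False
    then obtain d where difference: "a e = a f + 2 + d" using balanced le_Suc_ex by blast
    have "(b e)\<^sup>2 + (b f)\<^sup>2 \<le> (a f + 1 + d)\<^sup>2 + (a f + 1)\<^sup>2"
      using balanced False difference \<open>b e < a e\<close> by (intro add_mono power_mono) auto
    also have "\<dots> < (a e)\<^sup>2 + (a f)\<^sup>2"
      by (simp add: difference power2_eq_square algebra_simps)
    finally show ?thesis
      using members rest False by (simp add: sum.remove[of E e] sum.remove[of "E - {e}" f])
  qed
qed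

lemma potential_exchange_less:
  assumes "finite E" "e \<in> E" "f \<in> E" "i < K" and improving: "improving V K Tr i e f"
  shows "potential E K (exchange_at i e f Tr) < potential E K Tr"
proof -
  let ?Tr = "exchange_at i e f Tr"
  have load_change: "load K ?Tr g + of_bool (g \<in> Tr i) =
      load K Tr g + of_bool (g \<in> insert f (Tr i) - {e})" for g
    unfolding exchange_at_def by (rule load_fun_upd[OF assms(4)])
  show ?thesis
    unfolding potential_def
  proof (rule sum_squares_less_if_balanced[OF assms(1-3)])
    show "load K ?Tr e < load K Tr e" using load_change[of e] improving by (simp add: improving_def)
    show "load K ?Tr f \<le> load K Tr f + 1 \<and> load K Tr f + 2 \<le> load K Tr e" if "f \<noteq> e"
      using load_change[of f] that improving by (auto simp: improving_def)
    show "load K ?Tr g = load K Tr g" if "g \<noteq> e" "g \<noteq> f" for g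
      using load_change[of g] that by simp
  qed
qed

lemma connected_family_exchange:
  assumes "connected_family V E K Tr" "f \<in> E" "improving V K Tr i e f"
  shows "connected_family V E K (exchange_at i e f Tr)"
  using assms by (auto simp: connected_family_def improving_def exchange_at_def)

lemma potential_le: "potential E K Tr \<le> card E * K\<^sup>2"
  using sum_bounded_above[of E "\<lambda>e. (load K Tr e)\<^sup>2" "K\<^sup>2", OF power_mono[OF load_le]]
  by (simp add: potential_def)

definition load_gap :: "'e set \<Rightarrow> ('e \<Rightarrow> nat) \<Rightarrow> nat \<Rightarrow> bool" where
  "load_gap E l j \<longleftrightarrow> Min (l ` E) \<le> j \<and> j < Min (l ` E) + card E \<and> Suc j \<notin> l ` E"

lemma interval_subset_image_less:
  fixes l :: "'e \<Rightarrow> nat"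
  assumes "finite E" "E \<noteq> {}" "{a..b} \<subseteq> l ` E"
  shows "b < a + card E"
proof -
  have "card {a..b} \<le> card E" using assms surj_card_le by blast
  moreover have "0 < card E" using assms by (simp add: card_gt_0_iff)
  ultimately show ?thesis by simp
qed

lemma ex_load_gap:
  fixes l :: "'e \<Rightarrow> nat"
  assumes "finite E" "E \<noteq> {}"
  shows "\<exists>j. load_gap E l j"
proof -
  let ?a = "Min (l ` E)"
  have "\<not> {?a..?a + card E} \<subseteq> l ` E"
    using interval_subset_image_less[OF assms, of ?a "?a + card E" l] by auto
  then obtain x where missing: "x \<in> {?a..?a + card E}" "x \<notin> l ` E" by blast
  moreover have "?a \<in> l ` E" using assms by (intro Min_in) auto
  ultimately have "?a < x" by (metis atLeastAtMost_iff le_neq_implies_less)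
  then obtain j where "x = Suc j" by (cases x) auto
  then have "load_gap E l j" using missing \<open>?a < x\<close> by (simp add: load_gap_def)
  then show ?thesis ..
qed

definition light_edges :: "'e set \<Rightarrow> nat \<Rightarrow> (nat \<Rightarrow> 'e set) \<Rightarrow> nat \<Rightarrow> 'e set" where
  "light_edges E K Tr j = {e \<in> E. load K Tr e \<le> j}"

lemma light_edges_subset: "light_edges E K Tr j \<subseteq> E"
  by (auto simp: light_edges_def)

locale connected_graph =
  fixes V :: "'a set" and E :: "'a set set"
  assumes simple: "simple_graph V E" and connected: "graph_connected V E" and nonempty: "E \<noteq> {}"
begin

lemma finite_edges: "finite E"
  by (rule simple_graph_finite[OF simple])

lemma card_edges_pos: "0 < card E"
  using finite_edges nonempty by (simp add: card_gt_0_iff)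

lemma light_edges_nonempty:
  assumes "load_gap E (load K Tr) j"
  shows "light_edges E K Tr j \<noteq> {}"
proof -
  have "Min (load K Tr ` E) \<in> load K Tr ` E" using finite_edges nonempty by (intro Min_in) auto
  then obtain e where "e \<in> E" "load K Tr e = Min (load K Tr ` E)" by auto
  then show ?thesis using assms by (auto simp: light_edges_def load_gap_def)
qed

lemma ex_locally_optimal: "\<exists>Tr. locally_optimal V E K Tr"
proof -
  have "connected_family V E K (\<lambda>_. E)" using connected by (simp add: connected_family_def)
  then obtain Tr where family: "connected_family V E K Tr"
    and least: "\<And>Tr'. connected_family V E K Tr' \<Longrightarrow> potential E K Tr \<le> potential E K Tr'"
    using ex_has_least_nat[of "connected_family V E K" _ "potential E K"] by blast
  have "\<not> improving V K Tr i e f" if "i < K" "e \<in> E" "f \<in> E" for i e f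
  proof
    assume improving: "improving V K Tr i e f"
    have "potential E K Tr \<le> potential E K (exchange_at i e f Tr)"
      by (rule least[OF connected_family_exchange[OF family that(3) improving]])
    then show False using potential_exchange_less[OF finite_edges that(2,3,1) improving] by simp
  qed
  then show ?thesis using family by (auto simp: locally_optimal_def)
qed

lemma spanning_tree_if_locally_optimal:
  assumes "locally_optimal V E K Tr" "i < K"
  shows "spanning_tree_of V E (Tr i)"
proof -
  have connected_member: "Tr i \<subseteq> E" "graph_connected V (Tr i)"
    using assms by (auto simp: locally_optimal_def connected_family_def)
  have "\<not> graph_connected V (Tr i - {e})" if "e \<in> Tr i" for e
  proof -
    have "e \<in> E" using that connected_member(1) by blast
    then have "\<not> improving V K Tr i e e" using assms by (simp add: locally_optimal_def)
    then show ?thesis using that by (simp add: improving_def insert_absorb)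
  qed
  then have "graph_tree V (Tr i)"
    using graph_treeI_minimal simple_graph_mono[OF simple connected_member(1)] connected_member(2)
    by blast
  then show ?thesis using connected_member(1) by (simp add: spanning_tree_of_def)
qed

lemma spanning_tree_of_max_spanning_tree: "spanning_tree_of V E (max_spanning_tree V E \<omega>)"
proof -
  obtain Tr where "locally_optimal V E 1 Tr" using ex_locally_optimal by blast
  then have "spanning_tree_of V E (Tr 0)" by (rule spanning_tree_if_locally_optimal) simp
  then show ?thesis by (rule max_spanning_tree_is_max(1)[OF finite_edges])
qed

end

section \<open>Optimal weightings\<close>

lemma fraction_le_if_close:
  fixes p q r s m :: nat
  assumes "0 < q" "q \<le> m" "0 < s" "s \<le> m"
    and close: "real r / real s \<le> real p / real q + \<delta>" "\<delta> * (real m)\<^sup>2 < 1" "0 \<le> \<delta>"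
  shows "real r / real s \<le> real p / real q"
proof -
  have "real r * real q \<le> real p * real s + \<delta> * (real q * real s)"
    using assms(1,3) close(1) by (simp add: field_simps)
  also have "\<delta> * (real q * real s) \<le> \<delta> * (real m)\<^sup>2"
    unfolding power2_eq_square using assms by (intro mult_left_mono mult_mono) auto
  finally have "real (r * q) < real (p * s + 1)" using close(2) by simp
  then have "r * q \<le> p * s" by linarith
  then have "real r * real q \<le> real p * real s" by (metis of_nat_le_iff of_nat_mult)
  then show ?thesis using assms(1,3) by (simp add: field_simps)
qed

context connected_graph
begin

lemma sum_weighting_pos:
  assumes "\<omega> \<in> weightings E"
  shows "0 < sum \<omega> E"
proof -
  obtain e where "e \<in> E" "0 < \<omega> e"
    using assms by (auto simp: weightings_def order.strict_iff_order)
  then show ?thesis using assms finite_edges by (intro sum_pos2[of E e]) (auto simp: weightings_def)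
qed

lemma weighting_ratio_ge_min_load:
  assumes optimal: "locally_optimal V E K Tr" and "0 < K" and weighting: "\<omega> \<in> weightings E"
  shows "real (Min (load K Tr ` E)) / real K \<le> weighting_ratio V E \<omega>"
proof -
  let ?l = "Min (load K Tr ` E)" and ?M = "sum \<omega> (max_spanning_tree V E \<omega>)"
  have "real ?l * sum \<omega> E = (\<Sum>e\<in>E. real ?l * \<omega> e)" by (simp add: sum_distrib_left)
  also have "\<dots> \<le> (\<Sum>e\<in>E. real (load K Tr e) * \<omega> e)"
    using weighting finite_edges by (intro sum_mono mult_right_mono) (auto simp: weightings_def)
  also have "\<dots> = (\<Sum>i<K. sum \<omega> (Tr i \<inter> E))" by (simp add: sum_Int_family finite_edges)
  also have "\<dots> \<le> (\<Sum>i<K. ?M)"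
  proof (rule sum_mono)
    fix i assume "i \<in> {..<K}"
    then have tree: "spanning_tree_of V E (Tr i)"
      using spanning_tree_if_locally_optimal[OF optimal] by simp
    then have "Tr i \<inter> E = Tr i" by (auto simp: spanning_tree_of_def)
    then show "sum \<omega> (Tr i \<inter> E) \<le> ?M"
      using max_spanning_tree_is_max(2)[OF finite_edges tree] by simp
  qed
  finally show ?thesis
    using \<open>0 < K\<close> sum_weighting_pos[OF weighting] by (simp add: weighting_ratio_def field_simps)
qed

lemma indicator_in_weightings: "F \<subseteq> E \<Longrightarrow> F \<noteq> {} \<Longrightarrow> indicator F \<in> weightings E"
  by (auto simp: weightings_def indicator_eq_0_iff)

lemma sum_indicator_eq: "A \<subseteq> E \<Longrightarrow> sum (indicat_real F) A = real (card (A \<inter> F))"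
  using sum_mult_indicator[of A "\<lambda>_. 1 :: real" F] finite_subset[OF _ finite_edges] by simp

lemma weighting_ratio_indicator:
  assumes "F \<subseteq> E"
  shows "weighting_ratio V E (indicator F) =
    real (card (max_spanning_tree V E (indicator F) \<inter> F)) / real (card F)"
  using spanning_tree_of_max_spanning_tree[of "indicator F"] assms
  by (simp add: weighting_ratio_def spanning_tree_of_def sum_indicator_eq Int_absorb1)

lemma light_edges_ratio:
  assumes optimal: "locally_optimal V E K Tr" and gap: "load_gap E (load K Tr) j"
    and i_less: "i < K"
  defines "L \<equiv> light_edges E K Tr j"
  shows "weighting_ratio V E (indicator L) = real (card (Tr i \<inter> L)) / real (card L)"
proof -
  let ?M = "max_spanning_tree V E (indicator L)"
  have tree: "spanning_tree_of V E (Tr i)"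
    by (rule spanning_tree_if_locally_optimal[OF optimal i_less])
  have max_tree: "spanning_tree_of V E ?M" by (rule spanning_tree_of_max_spanning_tree)
  have "card (?M \<inter> L) \<le> card (Tr i \<inter> L)"
  proof (rule graph_tree_card_Int_le)
    show "graph_tree V (Tr i)" "graph_tree V ?M"
      using tree max_tree by (simp_all add: spanning_tree_of_def)
    fix e f assume "e \<in> Tr i - L" "f \<in> L"
    then have heavy: "e \<in> Tr i" "e \<in> E" "j < load K Tr e" and light: "f \<in> E" "load K Tr f \<le> j"
      using tree by (auto simp: L_def light_edges_def spanning_tree_of_def)
    have "load K Tr e \<noteq> Suc j" using gap heavy(2) unfolding load_gap_def by (metis imageI)
    then have "load K Tr f + 2 \<le> load K Tr e" using heavy(3) light(2) by linarith
    moreover have "f \<noteq> e" using heavy(3) light(2) by auto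
    moreover have "\<not> improving V K Tr i e f"
      using optimal i_less heavy(2) light(1) by (simp add: locally_optimal_def)
    ultimately show "\<not> graph_connected V (insert f (Tr i - {e}))"
      using heavy(1) by (auto simp: improving_def insert_Diff_if)
  qed
  moreover have "card (Tr i \<inter> L) \<le> card (?M \<inter> L)"
    using max_spanning_tree_is_max(2)[OF finite_edges tree, of "indicator L"] tree max_tree
    by (simp add: sum_indicator_eq spanning_tree_of_def)
  ultimately show ?thesis
    using weighting_ratio_indicator[of L] by (simp add: L_def light_edges_subset)
qed

lemma light_edges_ratio_le:
  assumes optimal: "locally_optimal V E K Tr" and gap: "load_gap E (load K Tr) j" and "0 < K"
  defines "L \<equiv> light_edges E K Tr j"
  shows "weighting_ratio V E (indicator L) \<le> real j / real K"
proof -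
  let ?r = "weighting_ratio V E (indicator L)"
  have "finite L" "L \<noteq> {}"
    using finite_subset[OF light_edges_subset finite_edges] light_edges_nonempty[OF gap]
    by (simp_all add: L_def)
  then have "0 < card L" by (simp add: card_gt_0_iff)
  have "real K * ?r * real (card L) = (\<Sum>i<K. ?r * real (card L))" by simp
  also have "\<dots> = (\<Sum>i<K. \<Sum>e\<in>Tr i \<inter> L. 1)"
    using light_edges_ratio[OF optimal gap] \<open>0 < card L\<close> by (intro sum.cong) (auto simp: L_def)
  also have "\<dots> = (\<Sum>e\<in>L. real (load K Tr e))"
    using \<open>finite L\<close> by (simp only: sum_Int_family mult_1_right)
  also have "\<dots> \<le> (\<Sum>e\<in>L. real j)" by (rule sum_mono) (simp add: L_def light_edges_def)
  finally have "real K * ?r \<le> real j" using \<open>0 < card L\<close> by simp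
  then show ?thesis using \<open>0 < K\<close> by (simp add: field_simps)
qed

lemma light_edges_near_optimal:
  assumes optimal: "locally_optimal V E K Tr" and gap: "load_gap E (load K Tr) j" and "0 < K"
    and weighting: "\<omega> \<in> weightings E"
  shows "weighting_ratio V E (indicator (light_edges E K Tr j))
    \<le> weighting_ratio V E \<omega> + (real (card E) - 1) / real K"
proof -
  have "Suc j \<le> Min (load K Tr ` E) + card E" using gap by (simp add: load_gap_def)
  then have "real j / real K \<le> (real (Min (load K Tr ` E)) + (real (card E) - 1)) / real K"
    by (intro divide_right_mono) linarith+
  also have "\<dots> \<le> weighting_ratio V E \<omega> + (real (card E) - 1) / real K"
    using weighting_ratio_ge_min_load[OF optimal \<open>0 < K\<close> weighting]
    by (simp add: add_divide_distrib)
  finally show ?thesis using light_edges_ratio_le[OF optimal gap \<open>0 < K\<close>] by linarith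
qed

lemma ex_optimal_indicator:
  obtains F where "F \<subseteq> E" "F \<noteq> {}"
    "\<And>\<omega>. \<omega> \<in> weightings E \<Longrightarrow> weighting_ratio V E (indicator F) \<le> weighting_ratio V E \<omega>"
proof -
  let ?S = "Pow E - {{}}" and ?r = "\<lambda>F. weighting_ratio V E (indicator F)"
  have "finite ?S" "?S \<noteq> {}" using finite_edges nonempty by auto
  then obtain F where F_in: "F \<in> ?S" and best: "\<And>L. L \<in> ?S \<Longrightarrow> ?r F \<le> ?r L"
    using ex_is_arg_min_if_finite[of ?S ?r] unfolding is_arg_min_linorder by blast
  have "?r F \<le> weighting_ratio V E \<omega>" if weighting: "\<omega> \<in> weightings E" for \<omega>
  proof (rule field_le_epsilon)
    fix \<epsilon> :: real assume "0 < \<epsilon>"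
    obtain k where "(real (card E) - 1) / \<epsilon> < real k" using reals_Archimedean2 by blast
    then have large: "(real (card E) - 1) / \<epsilon> \<le> real (Suc k)" by simp
    obtain Tr where optimal: "locally_optimal V E (Suc k) Tr" using ex_locally_optimal by blast
    obtain j where gap: "load_gap E (load (Suc k) Tr) j"
      using ex_load_gap[OF finite_edges nonempty] by blast
    let ?L = "light_edges E (Suc k) Tr j"
    have "?r F \<le> ?r ?L"
      using best[of ?L] light_edges_subset[of E "Suc k" Tr j] light_edges_nonempty[OF gap] by simp
    also have "\<dots> \<le> weighting_ratio V E \<omega> + (real (card E) - 1) / real (Suc k)"
      by (rule light_edges_near_optimal[OF optimal gap _ weighting]) simp
    also have "(real (card E) - 1) / real (Suc k) \<le> \<epsilon>"
      using large \<open>0 < \<epsilon>\<close> by (simp add: field_simps)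
    finally show "?r F \<le> weighting_ratio V E \<omega> + \<epsilon>" by simp
  qed
  then show ?thesis using F_in that by blast
qed

theorem light_edges_optimal:
  assumes optimal: "locally_optimal V E K Tr" and gap: "load_gap E (load K Tr) j"
    and large: "card E ^ 3 \<le> K"
  shows "weighting_ratio V E (indicator (light_edges E K Tr j)) = min_weighting_ratio V E"
proof -
  let ?m = "card E" and ?L = "light_edges E K Tr j"
  let ?r = "\<lambda>F. weighting_ratio V E (indicator F)"
  let ?rank = "\<lambda>F. card (max_spanning_tree V E (indicator F) \<inter> F)"
  have "0 < K" using large card_edges_pos by (metis gr_zeroI le_zero_eq power_not_zero)
  have light: "?L \<subseteq> E" "?L \<noteq> {}" by (rule light_edges_subset, rule light_edges_nonempty[OF gap])
  obtain F where minimizer: "F \<subseteq> E" "F \<noteq> {}" "\<And>\<omega>. \<omega> \<in> weightings E \<Longrightarrow> ?r F \<le> weighting_ratio V E \<omega>"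
    using ex_optimal_indicator by blast
  note fractions = weighting_ratio_indicator[OF minimizer(1)] weighting_ratio_indicator[OF light(1)]
  have "?r ?L \<le> ?r F"
    unfolding fractions
  proof (rule fraction_le_if_close)
    have "finite F" "finite ?L" using finite_subset finite_edges minimizer(1) light(1) by blast+
    then show "0 < card F" "0 < card ?L"
      using minimizer(2) light(2) by (simp_all add: card_gt_0_iff)
    show "card F \<le> ?m" "card ?L \<le> ?m"
      using finite_edges minimizer(1) light(1) by (simp_all add: card_mono)
    have "indicator F \<in> weightings E" by (rule indicator_in_weightings[OF minimizer(1,2)])
    then show "real (?rank ?L) / real (card ?L)
        \<le> real (?rank F) / real (card F) + (real ?m - 1) / real K"
      unfolding fractions[symmetric] by (rule light_edges_near_optimal[OF optimal gap \<open>0 < K\<close>])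
    show "0 \<le> (real ?m - 1) / real K" using card_edges_pos by simp
    have "(real ?m - 1) * (real ?m)\<^sup>2 < real ?m ^ 3"
      using card_edges_pos by (simp add: power3_eq_cube power2_eq_square left_diff_distrib)
    also have "\<dots> \<le> real K" using large by (metis of_nat_le_iff of_nat_power)
    finally show "(real ?m - 1) / real K * (real ?m)\<^sup>2 < 1" using \<open>0 < K\<close> by (simp add: field_simps)
  qed
  then have "?r ?L \<le> weighting_ratio V E \<omega>" if "\<omega> \<in> weightings E" for \<omega>
    using minimizer(3)[OF that] by linarith
  then show ?thesis
    unfolding min_weighting_ratio_def
    using indicator_in_weightings[OF light] by (intro cInf_eq_minimum[symmetric]) auto
qed

end

section \<open>Running times of programs\<close>

definition equal_outside :: "vname set \<Rightarrow> state \<Rightarrow> state \<Rightarrow> bool" where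
  "equal_outside X s s' \<longleftrightarrow> (\<forall>x. x \<notin> X \<longrightarrow> s' x = s x)"

lemma equal_outsideD: "equal_outside X s s' \<Longrightarrow> x \<notin> X \<Longrightarrow> s' x = s x"
  by (simp add: equal_outside_def)

lemma equal_outside_refl: "equal_outside X s s"
  by (simp add: equal_outside_def)

lemma equal_outside_trans:
  "equal_outside X s s' \<Longrightarrow> equal_outside Y s' s'' \<Longrightarrow> equal_outside (X \<union> Y) s s''"
  by (simp add: equal_outside_def)

primrec written :: "com \<Rightarrow> vname set" where
  "written Skip = {}"
| "written (Assign x i a) = {x}"
| "written (Seq c1 c2) = written c1 \<union> written c2"
| "written (Cond b c1 c2) = written c1 \<union> written c2"
| "written (While b c) = written c"

lemma exec_equal_outside_written: "exec c s t s' \<Longrightarrow> equal_outside (written c) s s'"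
  by (induction rule: exec.induct) (auto simp: equal_outside_def)

definition runs :: "com \<Rightarrow> state \<Rightarrow> nat \<Rightarrow> (state \<Rightarrow> bool) \<Rightarrow> bool" where
  "runs c s T Q \<longleftrightarrow> (\<exists>t s'. exec c s t s' \<and> t \<le> T \<and> Q s')"

lemma runs_mono:
  assumes "runs c s T Q" "T \<le> T'" "\<And>s'. Q s' \<Longrightarrow> equal_outside (written c) s s' \<Longrightarrow> Q' s'"
  shows "runs c s T' Q'"
  using assms unfolding runs_def by (meson exec_equal_outside_written le_trans)

lemma runs_Seq:
  assumes "runs c1 s T1 P" "\<And>s'. P s' \<Longrightarrow> equal_outside (written c1) s s' \<Longrightarrow> runs c2 s' T2 Q"
  shows "runs (Seq c1 c2) s (T1 + T2) Q"
proof -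
  obtain t1 s1 where first: "exec c1 s t1 s1" "t1 \<le> T1" "P s1"
    using assms(1) by (auto simp: runs_def)
  obtain t2 s2 where "exec c2 s1 t2 s2" "t2 \<le> T2" "Q s2"
    using assms(2)[OF first(3) exec_equal_outside_written[OF first(1)]] by (auto simp: runs_def)
  then show ?thesis unfolding runs_def using exec_Seq first add_mono by meson
qed

text \<open>
  The values of \<open>effect\<close> and \<open>ccost\<close> at loops are junk: both are used only for loop-free programs.
\<close>

primrec effect :: "com \<Rightarrow> state \<Rightarrow> state" where
  "effect Skip s = s"
| "effect (Assign x i a) s = s(x := (s x)(aval i s := aval a s))"
| "effect (Seq c1 c2) s = effect c2 (effect c1 s)"
| "effect (Cond b c1 c2) s = (if bval b s then effect c1 s else effect c2 s)"
| "effect (While b c) s = s"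

primrec ccost :: "com \<Rightarrow> nat" where
  "ccost Skip = 1"
| "ccost (Assign x i a) = 1 + acost i + acost a"
| "ccost (Seq c1 c2) = ccost c1 + ccost c2"
| "ccost (Cond b c1 c2) = 1 + bcost b + max (ccost c1) (ccost c2)"
| "ccost (While b c) = 0"

primrec loop_free :: "com \<Rightarrow> bool" where
  "loop_free Skip \<longleftrightarrow> True"
| "loop_free (Assign x i a) \<longleftrightarrow> True"
| "loop_free (Seq c1 c2) \<longleftrightarrow> loop_free c1 \<and> loop_free c2"
| "loop_free (Cond b c1 c2) \<longleftrightarrow> loop_free c1 \<and> loop_free c2"
| "loop_free (While b c) \<longleftrightarrow> False"

lemma exec_loop_free: "loop_free c \<Longrightarrow> \<exists>t\<le>ccost c. exec c s t (effect c s)"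
proof (induction c arbitrary: s)
  case Skip
  show ?case using exec_Skip by auto
next
  case (Assign x i a)
  show ?case using exec_Assign[of x i a s] by (metis ccost.simps(2) effect.simps(2) order_refl)
next
  case (Seq c1 c2)
  then show ?case by simp (meson add_mono exec_Seq)
next
  case (Cond b c1 c2)
  then obtain t1 t2 where left: "t1 \<le> ccost c1" "exec c1 s t1 (effect c1 s)"
    and right: "t2 \<le> ccost c2" "exec c2 s t2 (effect c2 s)" by fastforce
  show ?case
  proof (cases "bval b s")
    case True
    then show ?thesis using exec_CondTrue[OF True left(2), of c2] left(1)
      by (intro exI[of _ "1 + bcost b + t1"]) auto
  next
    case False
    then show ?thesis using exec_CondFalse[OF False right(2), of c1] right(1)
      by (intro exI[of _ "1 + bcost b + t2"]) auto
  qed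
qed simp

lemma runs_loop_free: "loop_free c \<Longrightarrow> Q (effect c s) \<Longrightarrow> runs c s (ccost c) Q"
  unfolding runs_def using exec_loop_free by blast

lemma runs_While:
  fixes \<mu> :: "state \<Rightarrow> nat"
  assumes "I s"
    and body: "\<And>s'. I s' \<Longrightarrow> equal_outside (written c) s s' \<Longrightarrow> bval b s' \<Longrightarrow>
      runs c s' T (\<lambda>s''. I s'' \<and> \<mu> s'' < \<mu> s')"
  shows "runs (While b c) s ((\<mu> s + 1) * (1 + bcost b + T)) (\<lambda>s'. I s' \<and> \<not> bval b s')"
proof -
  let ?T = "1 + bcost b + T"
  have "runs (While b c) s' ((\<mu> s' + 1) * ?T) (\<lambda>s'. I s' \<and> \<not> bval b s')"
    if "I s'" "equal_outside (written c) s s'" for s'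
    using that
  proof (induction "\<mu> s'" arbitrary: s' rule: less_induct)
    case less
    show ?case
    proof (cases "bval b s'")
      case False
      then show ?thesis unfolding runs_def using exec_WhileFalse[OF False, of c] less.prems(1)
        by (intro exI[of _ "1 + bcost b"] exI[of _ s']) simp
    next
      case True
      obtain t s1 where round: "exec c s' t s1" "t \<le> T" "I s1" "\<mu> s1 < \<mu> s'"
        using body[OF less.prems True] by (auto simp: runs_def)
      have "equal_outside (written c) s s1"
        using equal_outside_trans[OF less.prems(2) exec_equal_outside_written[OF round(1)]] by simp
      from less.hyps[OF round(4,3) this] obtain u s2
        where rest: "exec (While b c) s1 u s2" "u \<le> (\<mu> s1 + 1) * ?T" "I s2" "\<not> bval b s2"
        by (auto simp: runs_def)
      have "(\<mu> s1 + 1) * ?T \<le> \<mu> s' * ?T" using round(4) by (intro mult_right_mono) auto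
      then have "1 + bcost b + t + u \<le> (\<mu> s' + 1) * ?T" using round(2) rest(2) by simp
      then show ?thesis
        unfolding runs_def using exec_WhileTrue[OF True round(1) rest(1)] rest(3,4) by blast
    qed
  qed
  then show ?thesis using assms(1) equal_outside_refl by blast
qed

abbreviation var :: "vname \<Rightarrow> aexp" where "var x \<equiv> Cell x (Lit 0)"
abbreviation set_var :: "vname \<Rightarrow> aexp \<Rightarrow> com" where "set_var x a \<equiv> Assign x (Lit 0) a"
abbreviation incr :: "vname \<Rightarrow> com" where "incr x \<equiv> set_var x (Add (var x) (Lit 1))"

notation Seq (infixr ";;" 60)

definition eqb :: "aexp \<Rightarrow> aexp \<Rightarrow> bexp" where
  "eqb a b = Conj (Neg (Less a b)) (Neg (Less b a))"

definition orb :: "bexp \<Rightarrow> bexp \<Rightarrow> bexp" where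
  "orb a b = Neg (Conj (Neg a) (Neg b))"

lemma bval_eqb [simp]: "bval (eqb a b) s \<longleftrightarrow> aval a s = aval b s"
  by (auto simp: eqb_def)

lemma bval_orb [simp]: "bval (orb a b) s \<longleftrightarrow> bval a s \<or> bval b s"
  by (simp add: orb_def)

definition scan :: "vname \<Rightarrow> com \<Rightarrow> com" where
  "scan x c = set_var ''k'' (Lit 0) ;; While (Less (var ''k'') (var x)) c"

definition scan_time :: "com \<Rightarrow> nat \<Rightarrow> nat" where
  "scan_time c M = 3 + (M + 1) * (6 + ccost c)"

lemma written_scan [simp]: "written (scan x c) = insert ''k'' (written c)"
  by (simp add: scan_def)

text \<open>The body \<open>c\<close> advances \<open>k\<close> itself, because some bodies restart the scan instead.\<close>

lemma runs_scan:
  fixes \<mu> :: "state \<Rightarrow> nat"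
  assumes body: "loop_free c" "x \<notin> written (scan x c)"
    and init: "I (s(''k'' := (s ''k'')(0 := 0)))" "\<mu> (s(''k'' := (s ''k'')(0 := 0))) \<le> M"
    and step: "\<And>s'. I s' \<Longrightarrow> equal_outside (written (scan x c)) s s' \<Longrightarrow> s' ''k'' 0 < s x 0 \<Longrightarrow>
      I (effect c s') \<and> \<mu> (effect c s') < \<mu> s'"
  shows "runs (scan x c) s (scan_time c M) (\<lambda>s'. I s' \<and> s x 0 \<le> s' ''k'' 0)"
proof -
  let ?b = "Less (var ''k'') (var x)"
  define s0 where "s0 = s(''k'' := (s ''k'')(0 := 0))"
  have reset: "runs (set_var ''k'' (Lit 0)) s (ccost (set_var ''k'' (Lit 0))) (\<lambda>s'. s' = s0)"
    by (rule runs_loop_free) (simp_all add: s0_def)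
  have loop: "runs (While ?b c) s0 ((\<mu> s0 + 1) * (1 + bcost ?b + ccost c))
      (\<lambda>s'. I s' \<and> s x 0 \<le> s' ''k'' 0)"
  proof (rule runs_mono[OF runs_While order_refl])
    have outside: "equal_outside (written (scan x c)) s s'"
      if "equal_outside (written c) s0 s'" for s'
      using that by (simp add: equal_outside_def s0_def)
    show "I s0" using init by (simp add: s0_def)
    show "runs c s' (ccost c) (\<lambda>s''. I s'' \<and> \<mu> s'' < \<mu> s')"
      if "I s'" "equal_outside (written c) s0 s'" "bval ?b s'" for s'
    proof (rule runs_loop_free[OF body(1)])
      have "s' ''k'' 0 < s x 0" using that(3) equal_outsideD[OF outside[OF that(2)] body(2)] by simp
      then show "I (effect c s') \<and> \<mu> (effect c s') < \<mu> s'"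
        using step that(1) outside[OF that(2)] by blast
    qed
    show "I s' \<and> s x 0 \<le> s' ''k'' 0"
      if "I s' \<and> \<not> bval ?b s'" "equal_outside (written (While ?b c)) s0 s'" for s'
      using that equal_outsideD[OF outside body(2)] by simp
  qed
  have time: "ccost (set_var ''k'' (Lit 0)) + (\<mu> s0 + 1) * (1 + bcost ?b + ccost c) \<le> scan_time c M"
    unfolding scan_time_def using init(2) by (intro add_mono mult_mono) (simp_all add: s0_def)
  show ?thesis
    unfolding scan_def by (rule runs_mono[OF runs_Seq[OF reset] time]) (use loop in simp_all)
qed

lemma runs_scan_restart:
  fixes progress :: "state \<Rightarrow> nat"
  assumes body: "loop_free c" "x \<notin> written (scan x c)" and limit: "s x 0 = M"
    and init: "I (s(''k'' := (s ''k'')(0 := 0)))"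
    and step: "\<And>s'. I s' \<Longrightarrow> equal_outside (written (scan x c)) s s' \<Longrightarrow> s' ''k'' 0 < M \<Longrightarrow>
      I (effect c s') \<and>
      (progress (effect c s') = progress s' \<and> effect c s' ''k'' 0 = Suc (s' ''k'' 0) \<or>
       progress s' < progress (effect c s') \<and> progress (effect c s') \<le> N)"
  shows "runs (scan x c) s (scan_time c (N * (M + 1) + M)) (\<lambda>s'. I s' \<and> M \<le> s' ''k'' 0)"
proof (rule runs_mono[OF runs_scan[OF body] order_refl])
  let ?\<mu> = "\<lambda>s'. (N - progress s') * (M + 1) + (M - s' ''k'' 0)"
  let ?s0 = "s(''k'' := (s ''k'')(0 := 0))"
  show "I ?s0" by (rule init)
  show "?\<mu> ?s0 \<le> N * (M + 1) + M" by (intro add_mono mult_le_mono1) simp_all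
  show "I (effect c s') \<and> ?\<mu> (effect c s') < ?\<mu> s'"
    if invariant: "I s'" and outside: "equal_outside (written (scan x c)) s s'"
      and k_less: "s' ''k'' 0 < s x 0" for s'
  proof -
    let ?s = "effect c s'"
    consider "progress ?s = progress s'" "?s ''k'' 0 = Suc (s' ''k'' 0)"
      | "progress s' < progress ?s" "progress ?s \<le> N"
      using step[OF invariant outside] k_less limit by auto
    then have "?\<mu> ?s < ?\<mu> s'"
    proof cases
      case 1
      then show ?thesis using k_less limit by simp
    next
      case 2
      have "?\<mu> ?s < Suc (N - progress ?s) * (M + 1)" by simp
      also have "\<dots> \<le> (N - progress s') * (M + 1)" using 2 by (intro mult_le_mono1) simp
      also have "\<dots> \<le> ?\<mu> s'" by simp
      finally show ?thesis .
    qed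
    then show ?thesis using step[OF invariant outside] k_less limit by simp
  qed
qed (use limit in simp)

lemma runs_scan_once:
  assumes body: "loop_free c" "x \<notin> written (scan x c)" and limit: "s x 0 = M"
    and init: "P 0 (s(''k'' := (s ''k'')(0 := 0)))"
    and step: "\<And>k s'. P k s' \<Longrightarrow> equal_outside (written (scan x c)) s s' \<Longrightarrow> s' ''k'' 0 = k \<Longrightarrow> k < M \<Longrightarrow>
      P (Suc k) (effect c s') \<and> effect c s' ''k'' 0 = Suc k"
  shows "runs (scan x c) s (scan_time c M) (P M)"
proof -
  let ?I = "\<lambda>s'. s' ''k'' 0 \<le> M \<and> P (s' ''k'' 0) s'"
  have "runs (scan x c) s (scan_time c (0 * (M + 1) + M)) (\<lambda>s'. ?I s' \<and> M \<le> s' ''k'' 0)"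
    by (rule runs_scan_restart[of c x s M ?I "\<lambda>_. 0" 0, OF body limit]) (use init step in auto)
  then show ?thesis by (rule runs_mono) (simp, metis le_antisym)
qed

definition multiply_step :: "vname \<Rightarrow> vname \<Rightarrow> com" where
  "multiply_step y z = set_var z (Add (var z) (var y)) ;; incr ''k''"

definition multiply :: "vname \<Rightarrow> vname \<Rightarrow> vname \<Rightarrow> com" where
  "multiply x y z = set_var z (Lit 0) ;; scan x (multiply_step y z)"

definition multiply_time :: "nat \<Rightarrow> nat" where
  "multiply_time N = 3 + scan_time (multiply_step [] []) N"

lemma written_multiply [simp]: "written (multiply x y z) = {z, ''k''}"
  by (auto simp: multiply_def multiply_step_def)

lemma runs_multiply:
  assumes "x \<notin> {z, ''k''}" "y \<notin> {z, ''k''}" "z \<noteq> ''k''"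
  shows "runs (multiply x y z) s (multiply_time (s x 0)) (\<lambda>s'. s' z 0 = s x 0 * s y 0)"
proof -
  let ?c = "multiply_step y z"
  have "runs (set_var z (Lit 0)) s (ccost (set_var z (Lit 0))) (\<lambda>s'. s' z 0 = 0)"
    by (rule runs_loop_free) simp_all
  moreover have "runs (scan x ?c) s1 (scan_time ?c (s x 0)) (\<lambda>s'. s' z 0 = s x 0 * s y 0)"
    if zero: "s1 z 0 = 0" "equal_outside (written (set_var z (Lit 0))) s s1" for s1
  proof (rule runs_scan_once[where P = "\<lambda>k s'. s' z 0 = k * s y 0"])
    have factors: "s1 x = s x" "s1 y = s y" using equal_outsideD[OF zero(2)] assms by simp_all
    then show "s1 x 0 = s x 0" by simp
    fix k s' assume "s' z 0 = k * s y 0" "equal_outside (written (scan x ?c)) s1 s'" "s' ''k'' 0 = k"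
    moreover from this(2) have "s' y = s y"
      using equal_outsideD[of _ s1 s' y] assms factors by (simp add: multiply_step_def)
    ultimately show "effect ?c s' z 0 = Suc k * s y 0 \<and> effect ?c s' ''k'' 0 = Suc k"
      using assms by (simp add: multiply_step_def)
  qed (use zero assms in \<open>simp_all add: multiply_step_def\<close>)
  ultimately have "runs (multiply x y z) s (ccost (set_var z (Lit 0)) + scan_time ?c (s x 0))
      (\<lambda>s'. s' z 0 = s x 0 * s y 0)"
    unfolding multiply_def by (rule runs_Seq)
  then show ?thesis by (simp add: multiply_time_def scan_time_def multiply_step_def)
qed

section \<open>Reading the input graph\<close>

locale input_graph = connected_graph "{..<n}" E for n :: nat and E :: "nat set set" +
  fixes es :: "(nat \<times> nat) list"
  assumes listing: "edge_listing es E"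
begin

abbreviation m :: nat where "m \<equiv> length es"

abbreviation src :: "nat \<Rightarrow> nat" where "src k \<equiv> fst (es ! k)"

abbreviation dst :: "nat \<Rightarrow> nat" where "dst k \<equiv> snd (es ! k)"

definition edge :: "nat \<Rightarrow> nat set" where
  "edge k = {src k, dst k}"

definition reads_input :: "state \<Rightarrow> bool" where
  "reads_input s \<longleftrightarrow> equal_outside (- {''n'', ''m'', ''src'', ''dst''}) (input_state n es) s"

lemma map_edge: "map (\<lambda>(u, v). {u, v}) es = map edge [0..<m]"
  by (rule nth_equalityI) (simp_all add: edge_def case_prod_beta)

lemma edges_eq: "E = edge ` {..<m}"
  using listing unfolding edge_listing_def map_edge by (simp add: atLeast0LessThan)

lemma inj_on_edge: "inj_on edge {..<m}"
  using listing unfolding edge_listing_def map_edge by (simp add: distinct_map atLeast0LessThan)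

lemma edge_in_edges: "k < m \<Longrightarrow> edge k \<in> E"
  by (simp add: edges_eq)

lemma edge_eq_iff: "k < m \<Longrightarrow> l < m \<Longrightarrow> edge k = edge l \<longleftrightarrow> k = l"
  by (simp add: inj_on_eq_iff[OF inj_on_edge])

lemma card_edges: "card E = m"
  by (simp add: edges_eq card_image[OF inj_on_edge])

lemma num_edges_pos: "0 < m"
  using card_edges_pos unfolding card_edges .

lemma endpoints_less:
  assumes "k < m"
  shows "src k < n" "dst k < n"
proof -
  have "edge k \<subseteq> {..<n}" using simple edge_in_edges[OF assms] by (auto simp: simple_graph_def)
  then show "src k < n" "dst k < n" by (simp_all add: edge_def)
qed

lemma num_vertices_pos: "0 < n"
  using endpoints_less(1)[OF num_edges_pos] by simp

lemma num_edges_le: "m \<le> n * n"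
proof -
  have "distinct es" using listing by (auto simp: edge_listing_def distinct_map)
  then have "m = card (set es)" by (simp add: distinct_card)
  also have "\<dots> \<le> card ({..<n} \<times> {..<n})"
  proof (rule card_mono)
    show "set es \<subseteq> {..<n} \<times> {..<n}"
      using endpoints_less by (fastforce simp: in_set_conv_nth mem_Times_iff)
  qed simp
  finally show ?thesis by (simp add: card_cartesian_product)
qed

lemma reads_inputD:
  assumes "reads_input s"
  shows "s ''n'' 0 = n" "s ''m'' 0 = m" "k < m \<Longrightarrow> s ''src'' k = src k" "k < m \<Longrightarrow> s ''dst'' k = dst k"
  using assms by (simp_all add: reads_input_def equal_outside_def input_state_def)

lemma reads_input_outside:
  assumes "reads_input s" "equal_outside X s s'" "X \<inter> {''n'', ''m'', ''src'', ''dst''} = {}"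
  shows "reads_input s'"
  using assms by (auto simp: reads_input_def equal_outside_def)

end

section \<open>Testing connectivity\<close>

definition clear_step :: com where
  "clear_step = Assign ''mark'' (var ''k'') (Lit 0) ;; incr ''k''"

definition reach_step :: "bexp \<Rightarrow> com" where
  "reach_step b = Cond
     (Conj b (Neg (eqb (Cell ''mark'' (Cell ''src'' (var ''k'')))
                       (Cell ''mark'' (Cell ''dst'' (var ''k''))))))
     (Assign ''mark'' (Cell ''src'' (var ''k'')) (Lit 1) ;;
      Assign ''mark'' (Cell ''dst'' (var ''k'')) (Lit 1) ;;
      incr ''count'' ;; set_var ''k'' (Lit 0))
     (incr ''k'')"

definition count_reachable :: "bexp \<Rightarrow> com" where
  "count_reachable b = scan ''n'' clear_step ;;
     (Assign ''mark'' (Lit 0) (Lit 1) ;; set_var ''count'' (Lit 1)) ;; scan ''m'' (reach_step b)"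

definition count_time :: "bexp \<Rightarrow> nat \<Rightarrow> nat \<Rightarrow> nat" where
  "count_time b n m = scan_time clear_step n + (6 + scan_time (reach_step b) (n * (m + 1) + m))"

lemma written_count_reachable [simp]: "written (count_reachable b) = {''mark'', ''count'', ''k''}"
  by (auto simp: count_reachable_def clear_step_def reach_step_def)

context input_graph
begin

definition reach_inv :: "nat set set \<Rightarrow> nat set \<Rightarrow> state \<Rightarrow> bool" where
  "reach_inv A S s \<longleftrightarrow> 0 \<in> S \<and> S \<subseteq> {..<n} \<and> (\<forall>v\<in>S. reachable A 0 v) \<and>
     (\<forall>v<n. s ''mark'' v = of_bool (v \<in> S)) \<and> s ''count'' 0 = card S \<and> s ''k'' 0 \<le> m \<and>
     (\<forall>l<s ''k'' 0. edge l \<in> A \<longrightarrow> (src l \<in> S \<longleftrightarrow> dst l \<in> S))"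

lemma reach_inv_count_le: "reach_inv A S s \<Longrightarrow> s ''count'' 0 \<le> n"
  using card_mono[of "{..<n}" S] by (simp add: reach_inv_def)

lemma reach_inv_extend:
  assumes inv: "reach_inv A S s" and crossing: "k < m" "edge k \<in> A" "src k \<in> S \<longleftrightarrow> dst k \<notin> S"
    and extended: "\<And>v. s' ''mark'' v = (if v \<in> edge k then 1 else s ''mark'' v)"
      "s' ''count'' 0 = Suc (s ''count'' 0)" "s' ''k'' 0 = 0"
  shows "reach_inv A (S \<union> edge k) s'"
proof -
  have "finite S" using inv finite_subset by (auto simp: reach_inv_def)
  then have "card (S \<union> edge k) = Suc (card S)"
    using crossing(3) by (cases "src k \<in> S") (auto simp: edge_def insert_absorb)
  moreover have "S \<union> edge k \<subseteq> {..<n}"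
    using inv crossing(1) endpoints_less by (auto simp: reach_inv_def edge_def)
  moreover have "reachable A 0 v" if "v \<in> edge k" for v
  proof -
    obtain u where "u \<in> S" "u \<in> edge k" using crossing(3) by (auto simp: edge_def)
    then have "reachable A 0 u" "u = v \<or> {u, v} = edge k"
      using inv that by (auto simp: reach_inv_def edge_def insert_commute)
    then show ?thesis using crossing(2) by (auto intro: rtranclp.rtrancl_into_rtrancl)
  qed
  ultimately show ?thesis using inv extended by (auto simp: reach_inv_def)
qed

lemma reach_inv_step:
  assumes inv: "reach_inv A S s" and input: "reads_input s" and "s ''k'' 0 < m"
    and guard: "bval b s \<longleftrightarrow> edge (s ''k'' 0) \<in> A"
  defines "s' \<equiv> effect (reach_step b) s"
  shows "(\<exists>S'. reach_inv A S' s') \<and>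
    (s' ''count'' 0 = s ''count'' 0 \<and> s' ''k'' 0 = Suc (s ''k'' 0) \<or>
     s ''count'' 0 < s' ''count'' 0 \<and> s' ''count'' 0 \<le> n)"
proof -
  define k where "k = s ''k'' 0"
  have k_less: "k < m" using \<open>s ''k'' 0 < m\<close> by (simp add: k_def)
  note cells = reads_inputD[OF input]
  have mark: "s ''mark'' (src k) = of_bool (src k \<in> S)" "s ''mark'' (dst k) = of_bool (dst k \<in> S)"
    using inv endpoints_less[OF k_less] by (auto simp: reach_inv_def)
  show ?thesis
  proof (cases "edge k \<in> A \<and> (src k \<in> S \<longleftrightarrow> dst k \<notin> S)")
    case True
    then have "s' = s(''mark'' := (s ''mark'')(src k := 1, dst k := 1),
        ''count'' := (s ''count'')(0 := Suc (s ''count'' 0)), ''k'' := (s ''k'')(0 := 0))"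
      using guard k_less by (auto simp: s'_def reach_step_def cells mark k_def[symmetric])
    then have "s' ''mark'' v = (if v \<in> edge k then 1 else s ''mark'' v)"
      and count: "s' ''count'' 0 = Suc (s ''count'' 0)" and "s' ''k'' 0 = 0" for v
      by (auto simp: edge_def)
    then have "reach_inv A (S \<union> edge k) s'" using reach_inv_extend[OF inv k_less] True by blast
    then show ?thesis using reach_inv_count_le[of A "S \<union> edge k" s'] count by auto
  next
    case False
    then have advanced: "s' = s(''k'' := (s ''k'')(0 := Suc k))"
      using guard k_less by (auto simp: s'_def reach_step_def cells mark k_def[symmetric])
    then have "reach_inv A S s'"
      using inv False k_less by (auto simp: reach_inv_def k_def less_Suc_eq)
    then show ?thesis by (auto simp: advanced k_def)
  qed
qed

lemma count_reachable_iff_connected: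
  assumes inv: "reach_inv A S s" and "m \<le> s ''k'' 0" and "A \<subseteq> E"
  shows "n \<le> s ''count'' 0 \<longleftrightarrow> graph_connected {..<n} A"
proof -
  have "graph_connected {..<n} A \<longleftrightarrow> S = {..<n}"
  proof (rule graph_connected_iff_closed_set)
    show "a \<in> S \<longleftrightarrow> b \<in> S" if "{a, b} \<in> A" for a b
    proof -
      have "{a, b} \<in> E" using that \<open>A \<subseteq> E\<close> by (rule subsetD[rotated])
      then obtain l where edge_l: "l < m" "{a, b} = edge l" unfolding edges_eq by (rule imageE) simp
      then have "src l \<in> S \<longleftrightarrow> dst l \<in> S" using inv that \<open>m \<le> s ''k'' 0\<close> by (simp add: reach_inv_def)
      then show ?thesis using edge_l(2) by (auto simp: edge_def doubleton_eq_iff)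
    qed
  qed (use inv in \<open>auto simp: reach_inv_def\<close>)
  moreover have "S = {..<n} \<longleftrightarrow> n \<le> card S"
    using inv card_seteq[of "{..<n}" S] by (auto simp: reach_inv_def)
  ultimately show ?thesis using inv by (simp add: reach_inv_def)
qed

lemma runs_clear:
  assumes "reads_input s"
  shows "runs (scan ''n'' clear_step) s (scan_time clear_step n) (\<lambda>s'. \<forall>v<n. s' ''mark'' v = 0)"
  by (rule runs_scan_once[where P = "\<lambda>k s'. \<forall>v<k. s' ''mark'' v = 0"])
    (auto simp: clear_step_def reads_inputD[OF assms] less_Suc_eq)

lemma runs_reach:
  assumes start: "reads_input s" "\<And>v. v < n \<Longrightarrow> s ''mark'' v = of_bool (v = 0)" "s ''count'' 0 = 1"
    and guard: "\<And>s'. equal_outside {''mark'', ''count'', ''k''} s s' \<Longrightarrow> s' ''k'' 0 < m \<Longrightarrow>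
      bval b s' \<longleftrightarrow> edge (s' ''k'' 0) \<in> A"
    and "A \<subseteq> E"
  shows "runs (scan ''m'' (reach_step b)) s (scan_time (reach_step b) (n * (m + 1) + m))
    (\<lambda>s'. n \<le> s' ''count'' 0 \<longleftrightarrow> graph_connected {..<n} A)"
proof (rule runs_mono[OF runs_scan_restart[where progress = "\<lambda>s'. s' ''count'' 0"] order_refl])
  let ?I = "\<lambda>s'. \<exists>S. reach_inv A S s'"
  have written: "written (scan ''m'' (reach_step b)) = {''mark'', ''count'', ''k''}"
    by (auto simp: reach_step_def)
  have "reach_inv A {0} (s(''k'' := (s ''k'')(0 := 0)))"
    using start(2,3) num_vertices_pos by (auto simp: reach_inv_def)
  then show "?I (s(''k'' := (s ''k'')(0 := 0)))" ..
  let ?next = "effect (reach_step b)"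
  show "?I (?next s') \<and>
      (?next s' ''count'' 0 = s' ''count'' 0 \<and> ?next s' ''k'' 0 = Suc (s' ''k'' 0) \<or>
       s' ''count'' 0 < ?next s' ''count'' 0 \<and> ?next s' ''count'' 0 \<le> n)"
    if inv: "?I s'" and outside: "equal_outside (written (scan ''m'' (reach_step b))) s s'"
      and k_less: "s' ''k'' 0 < m" for s'
  proof -
    note outside = outside[unfolded written]
    obtain S where "reach_inv A S s'" using inv by blast
    moreover have "reads_input s'" using reads_input_outside[OF start(1) outside] by simp
    ultimately show ?thesis using k_less guard[OF outside k_less] by (rule reach_inv_step)
  qed
  show "n \<le> s' ''count'' 0 \<longleftrightarrow> graph_connected {..<n} A" if "?I s' \<and> m \<le> s' ''k'' 0" for s'
    using that count_reachable_iff_connected[OF _ _ \<open>A \<subseteq> E\<close>] by auto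
qed (use reads_inputD(2)[OF start(1)] in \<open>simp_all add: reach_step_def\<close>)

lemma runs_count_reachable:
  assumes input: "reads_input s"
    and guard: "\<And>s'. equal_outside {''mark'', ''count'', ''k''} s s' \<Longrightarrow> s' ''k'' 0 < m \<Longrightarrow>
      bval b s' \<longleftrightarrow> edge (s' ''k'' 0) \<in> A"
    and "A \<subseteq> E"
  shows "runs (count_reachable b) s (count_time b n m)
    (\<lambda>s'. n \<le> s' ''count'' 0 \<longleftrightarrow> graph_connected {..<n} A)"
proof -
  let ?init = "Assign ''mark'' (Lit 0) (Lit 1) ;; set_var ''count'' (Lit 1)"
  let ?marked = "\<lambda>s'. (\<forall>v<n. s' ''mark'' v = of_bool (v = 0)) \<and> s' ''count'' 0 = 1"
  have init: "runs ?init s1 6 ?marked" if "\<forall>v<n. s1 ''mark'' v = 0" for s1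
    by (rule runs_mono[OF runs_loop_free[of ?init ?marked]]) (use that in auto)
  have reach: "runs (scan ''m'' (reach_step b)) s2 (scan_time (reach_step b) (n * (m + 1) + m))
      (\<lambda>s'. n \<le> s' ''count'' 0 \<longleftrightarrow> graph_connected {..<n} A)"
    if "?marked s2" "equal_outside {''mark'', ''count'', ''k''} s s2" for s2
  proof (rule runs_reach)
    show "reads_input s2" using reads_input_outside[OF input that(2)] by simp
    show "bval b s' \<longleftrightarrow> edge (s' ''k'' 0) \<in> A"
      if "equal_outside {''mark'', ''count'', ''k''} s2 s'" "s' ''k'' 0 < m" for s'
      using guard[of s'] that(2) equal_outside_trans[OF \<open>equal_outside _ s s2\<close> that(1)] by simp
  qed (use that \<open>A \<subseteq> E\<close> in auto)
  show ?thesis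
    unfolding count_reachable_def count_time_def
  proof (rule runs_Seq[OF runs_clear[OF input] runs_Seq[OF init reach]])
    fix s1 s2
    assume "equal_outside (written (scan ''n'' clear_step)) s s1"
      "equal_outside (written ?init) s1 s2"
    then show "equal_outside {''mark'', ''count'', ''k''} s s2"
      by (auto simp: equal_outside_def clear_step_def)
  qed
qed

end

section \<open>Local search\<close>

text \<open>
  Row \<open>i\<close> (cells \<open>i * m, \<dots>, i * m + m - 1\<close>) of the array \<open>absent\<close> is the complement of the \<open>i\<close>-th
  edge set, so that the zero-initialised memory describes a family in which every member is the whole
  edge set. The variable \<open>base\<close> holds \<open>i * m\<close> for the member under consideration, and \<open>in_exchange\<close>
  tests whether edge \<open>k\<close> belongs to that member plus \<open>f\<close> minus \<open>e\<close>.
\<close>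

definition in_exchange :: bexp where
  "in_exchange = Conj (Neg (eqb (var ''k'') (var ''e'')))
     (orb (eqb (var ''k'') (var ''f''))
       (Less (Cell ''absent'' (Add (var ''base'') (var ''k''))) (Lit 1)))"

definition reduces_loads :: bexp where
  "reduces_loads = Conj (Less (Cell ''absent'' (Add (var ''base'') (var ''e''))) (Lit 1))
     (orb (eqb (var ''f'') (var ''e''))
       (Neg (Less (Cell ''load'' (var ''e'')) (Add (Cell ''load'' (var ''f'')) (Lit 2)))))"

definition exchange_step :: com where
  "exchange_step =
     Assign ''load'' (var ''f'')
       (Add (Cell ''load'' (var ''f'')) (Cell ''absent'' (Add (var ''base'') (var ''f'')))) ;;
     Assign ''load'' (var ''e'') (Monus (Cell ''load'' (var ''e'')) (Lit 1)) ;;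
     Assign ''absent'' (Add (var ''base'') (var ''f'')) (Lit 0) ;;
     Assign ''absent'' (Add (var ''base'') (var ''e'')) (Lit 1) ;;
     set_var ''base'' (Lit 0) ;; set_var ''e'' (Lit 0) ;; set_var ''f'' (Lit 0)"

definition advance_step :: com where
  "advance_step = incr ''f'' ;; Cond (Less (var ''f'') (var ''m'')) Skip
     (set_var ''f'' (Lit 0) ;; incr ''e'' ;; Cond (Less (var ''e'') (var ''m'')) Skip
       (set_var ''e'' (Lit 0) ;; set_var ''base'' (Add (var ''base'') (var ''m''))))"

definition search_step :: com where
  "search_step = Cond (Conj reduces_loads (Neg (Less (var ''count'') (var ''n''))))
     exchange_step advance_step"

definition search :: com where
  "search = While (Less (var ''base'') (var ''cells'')) (count_reachable in_exchange ;; search_step)"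

lemma flat_index_eq_iff:
  fixes a b a' b' m :: nat
  assumes "b < m" "b' < m"
  shows "a * m + b = a' * m + b' \<longleftrightarrow> a = a' \<and> b = b'"
proof
  assume equal: "a * m + b = a' * m + b'"
  have "(a * m + b) div m = a" "(a' * m + b') div m = a'" using assms by simp_all
  then have "a = a'" using equal by simp
  then show "a = a' \<and> b = b'" using equal by simp
qed simp

context input_graph
begin

definition K :: nat where "K = m ^ 3"

definition family :: "state \<Rightarrow> nat \<Rightarrow> nat set set" where
  "family s i = edge ` {k. k < m \<and> s ''absent'' (i * m + k) = 0}"

definition family_inv :: "state \<Rightarrow> bool" where
  "family_inv s \<longleftrightarrow> (\<forall>q. s ''absent'' q \<le> 1) \<and> (\<forall>k<m. s ''load'' k = load K (family s) (edge k)) \<and>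
     connected_family {..<n} E K (family s)"

definition position :: "nat \<Rightarrow> nat \<Rightarrow> nat \<Rightarrow> nat" where
  "position i e f = (i * m + e) * m + f"

definition cursor :: "state \<Rightarrow> nat" where
  "cursor s = (s ''base'' 0 + s ''e'' 0) * m + s ''f'' 0"

definition cursor_inv :: "state \<Rightarrow> nat \<Rightarrow> bool" where
  "cursor_inv s i \<longleftrightarrow> i \<le> K \<and> s ''base'' 0 = i * m \<and> s ''e'' 0 < m \<and> s ''f'' 0 < m"

definition scan_inv :: "state \<Rightarrow> bool" where
  "scan_inv s \<longleftrightarrow> (\<exists>i. cursor_inv s i) \<and>
     (\<forall>i<K. \<forall>e<m. \<forall>f<m. position i e f < cursor s \<longrightarrow>
        \<not> improving {..<n} K (family s) i (edge e) (edge f))"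

definition num_positions :: nat where
  "num_positions = (K * m + m) * m"

definition search_measure :: "state \<Rightarrow> nat" where
  "search_measure s = potential E K (family s) * (num_positions + 1) + (num_positions - cursor s)"

lemma edge_in_family_iff: "k < m \<Longrightarrow> edge k \<in> family s i \<longleftrightarrow> s ''absent'' (i * m + k) = 0"
  by (auto simp: family_def edge_eq_iff)

lemma family_subset: "family s i \<subseteq> E"
  by (auto simp: family_def edges_eq)

lemma subsets_eqI:
  assumes "A \<subseteq> E" "B \<subseteq> E" "\<And>k. k < m \<Longrightarrow> edge k \<in> A \<longleftrightarrow> edge k \<in> B"
  shows "A = B"
  using assms unfolding edges_eq by blast

lemma family_cong: "s' ''absent'' = s ''absent'' \<Longrightarrow> family s' = family s"
  by (simp add: family_def fun_eq_iff)

lemma search_invs_outside: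
  assumes "equal_outside X s s'" "X \<inter> {''absent'', ''load'', ''base'', ''e'', ''f''} = {}"
  shows "family s' = family s" "family_inv s' = family_inv s" "cursor s' = cursor s"
    "cursor_inv s' i = cursor_inv s i" "scan_inv s' = scan_inv s"
    "search_measure s' = search_measure s"
proof -
  have arrays: "s' ''absent'' = s ''absent''" "s' ''load'' = s ''load''" "s' ''base'' = s ''base''"
    "s' ''e'' = s ''e''" "s' ''f'' = s ''f''"
    using assms(2) by (auto intro!: equal_outsideD[OF assms(1)])
  show "family s' = family s" by (rule family_cong[of s' s, OF arrays(1)])
  then show "family_inv s' = family_inv s" "cursor s' = cursor s" "cursor_inv s' i = cursor_inv s i"
    "scan_inv s' = scan_inv s" "search_measure s' = search_measure s"
    using arrays
    by (simp_all add: family_inv_def cursor_def cursor_inv_def scan_inv_def search_measure_def)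
qed

lemma family_exchange_step:
  assumes cursor: "cursor_inv s i"
  shows "family (effect exchange_step s) =
    exchange_at i (edge (s ''e'' 0)) (edge (s ''f'' 0)) (family s)"
proof
  fix i'
  let ?e = "s ''e'' 0" and ?f = "s ''f'' 0"
  have indices: "?e < m" "?f < m" using cursor by (simp_all add: cursor_inv_def)
  have absent: "effect exchange_step s ''absent'' = (s ''absent'')(i * m + ?f := 0, i * m + ?e := 1)"
    using cursor by (simp add: exchange_step_def cursor_inv_def)
  show "family (effect exchange_step s) i' = exchange_at i (edge ?e) (edge ?f) (family s) i'"
  proof (rule subsets_eqI)
    show "exchange_at i (edge ?e) (edge ?f) (family s) i' \<subseteq> E"
      using family_subset[of s] edge_in_edges[OF indices(2)] by (auto simp: exchange_at_def)
    show "edge k \<in> family (effect exchange_step s) i' \<longleftrightarrow>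
      edge k \<in> exchange_at i (edge ?e) (edge ?f) (family s) i'" if "k < m" for k
      using that indices
      by (auto simp: edge_in_family_iff absent flat_index_eq_iff exchange_at_def edge_eq_iff)
  qed (rule family_subset)
qed

lemma load_exchange_step:
  assumes inv: "family_inv s" and cursor: "cursor_inv s i" "i < K" and k_less: "k < m"
    and member: "edge (s ''e'' 0) \<in> family s i"
  shows "effect exchange_step s ''load'' k = load K (family (effect exchange_step s)) (edge k)"
proof -
  let ?e = "s ''e'' 0" and ?f = "s ''f'' 0" and ?s = "effect exchange_step s"
  have indices: "?e < m" "?f < m" using cursor(1) by (simp_all add: cursor_inv_def)
  have "load K (family ?s) (edge k) + of_bool (edge k \<in> family s i) =
      load K (family s) (edge k) + of_bool (edge k \<in> insert (edge ?f) (family s i) - {edge ?e})"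
    unfolding family_exchange_step[OF cursor(1)] exchange_at_def
    by (rule load_fun_upd[OF cursor(2)])
  moreover have "load K (family s) (edge k) = s ''load'' k"
    using inv k_less by (simp add: family_inv_def)
  moreover have "s ''absent'' (i * m + ?f) \<le> 1" using inv by (simp add: family_inv_def)
  then have "s ''absent'' (i * m + ?f) = of_bool (edge ?f \<notin> family s i)"
    using indices(2) by (auto simp: edge_in_family_iff)
  then have "?s ''load'' k =
      s ''load'' k + of_bool (k = ?f \<and> edge ?f \<notin> family s i) - of_bool (k = ?e)"
    using cursor(1) by (simp add: exchange_step_def cursor_inv_def)
  ultimately show ?thesis
    using member k_less indices by (cases "k = ?e"; cases "k = ?f") (auto simp: edge_eq_iff)
qed

lemma family_inv_exchange_step:
  assumes inv: "family_inv s" and cursor: "cursor_inv s i" "i < K"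
    and improving: "improving {..<n} K (family s) i (edge (s ''e'' 0)) (edge (s ''f'' 0))"
  shows "family_inv (effect exchange_step s)"
proof -
  have "edge (s ''f'' 0) \<in> E" using cursor(1) by (simp add: cursor_inv_def edge_in_edges)
  then have "connected_family {..<n} E K (family (effect exchange_step s))"
    unfolding family_exchange_step[OF cursor(1)]
    using connected_family_exchange[OF _ _ improving] inv by (simp add: family_inv_def)
  moreover have "effect exchange_step s ''absent'' q \<le> 1" for q
    using inv by (simp add: exchange_step_def family_inv_def)
  ultimately show ?thesis
    using load_exchange_step[OF inv cursor] improving by (simp add: family_inv_def improving_def)
qed

lemma potential_exchange_step_less:
  assumes cursor: "cursor_inv s i" "i < K"
    and improving: "improving {..<n} K (family s) i (edge (s ''e'' 0)) (edge (s ''f'' 0))"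
  shows "potential E K (family (effect exchange_step s)) < potential E K (family s)"
  unfolding family_exchange_step[OF cursor(1)]
  by (rule potential_exchange_less[OF finite_edges _ _ cursor(2) improving])
    (use cursor(1) in \<open>simp_all add: cursor_inv_def edge_in_edges\<close>)

lemma position_eq_iff:
  assumes "e < m" "f < m" "e' < m" "f' < m"
  shows "position i e f = position i' e' f' \<longleftrightarrow> i = i' \<and> e = e' \<and> f = f'"
  using assms by (simp add: position_def flat_index_eq_iff)

lemma cursor_eq_position: "cursor_inv s i \<Longrightarrow> cursor s = position i (s ''e'' 0) (s ''f'' 0)"
  by (simp add: cursor_def cursor_inv_def position_def)

lemma position_less:
  assumes "e < m" "f < m" "i < j"
  shows "position i e f < j * m * m"
proof -
  have "i * m + e < j * m"
    using assms mult_le_mono1[of "Suc i" j m] by simp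
  then have "Suc (i * m + e) * m \<le> j * m * m" by (intro mult_le_mono1) simp
  then show ?thesis using assms(2) by (simp add: position_def)
qed

lemma cursor_less_num_positions: "cursor_inv s i \<Longrightarrow> cursor s < num_positions"
  using position_less[of "s ''e'' 0" "s ''f'' 0" i "Suc K"]
  by (simp add: cursor_eq_position) (simp add: cursor_inv_def num_positions_def add_mult_distrib)

lemma advance_step_cursor:
  assumes cursor: "cursor_inv s i" "i < K" and size: "s ''m'' 0 = m"
  shows "cursor (effect advance_step s) = Suc (cursor s) \<and> (\<exists>j. cursor_inv (effect advance_step s) j)"
proof -
  let ?s = "effect advance_step s"
  consider "Suc (s ''f'' 0) < m" | "Suc (s ''f'' 0) = m" "Suc (s ''e'' 0) < m"
    | "Suc (s ''f'' 0) = m" "Suc (s ''e'' 0) = m"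
    using cursor(1) unfolding cursor_inv_def by linarith
  then show ?thesis
  proof cases
    case 1
    then have "cursor_inv ?s i" using cursor size by (simp add: advance_step_def cursor_inv_def)
    then show ?thesis using 1 size by (auto simp: advance_step_def cursor_def)
  next
    case 2
    then have "cursor_inv ?s i"
      using cursor size num_edges_pos by (simp add: advance_step_def cursor_inv_def)
    moreover have "cursor ?s = (s ''base'' 0 + s ''e'' 0) * m + m"
      using 2 size by (simp add: advance_step_def cursor_def)
    ultimately show ?thesis using 2(1) by (auto simp: cursor_def)
  next
    case 3
    then have "cursor_inv ?s (Suc i)"
      using cursor size num_edges_pos by (simp add: advance_step_def cursor_inv_def)
    moreover have "cursor ?s = (s ''base'' 0 + Suc (s ''e'' 0)) * m"
      using 3 size by (simp add: advance_step_def cursor_def)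
    ultimately show ?thesis using 3(1) by (auto simp: cursor_def)
  qed
qed

lemma scan_inv_advance_step:
  assumes inv: "scan_inv s" and cursor: "cursor_inv s i" "i < K" and size: "s ''m'' 0 = m"
    and not_improving: "\<not> improving {..<n} K (family s) i (edge (s ''e'' 0)) (edge (s ''f'' 0))"
  shows "scan_inv (effect advance_step s)"
proof -
  let ?s = "effect advance_step s"
  have family: "family ?s = family s" by (rule family_cong) (simp add: advance_step_def)
  have "\<not> improving {..<n} K (family s) i' (edge e') (edge f')"
    if bounds: "i' < K" "e' < m" "f' < m" and less: "position i' e' f' < Suc (cursor s)"
      for i' e' f'
  proof (cases "position i' e' f' = cursor s")
    case True
    then have "i' = i \<and> e' = s ''e'' 0 \<and> f' = s ''f'' 0"
      using bounds cursor(1) position_eq_iff[of e' f' "s ''e'' 0" "s ''f'' 0" i' i]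
      by (simp add: cursor_eq_position cursor_inv_def)
    then show ?thesis using not_improving by simp
  next
    case False
    then show ?thesis using inv bounds less by (simp add: scan_inv_def)
  qed
  then show ?thesis
    using advance_step_cursor[OF cursor size] by (simp add: scan_inv_def family)
qed

lemma scan_inv_start: "s ''base'' 0 = 0 \<Longrightarrow> s ''e'' 0 = 0 \<Longrightarrow> s ''f'' 0 = 0 \<Longrightarrow> scan_inv s"
  using num_edges_pos by (auto simp: scan_inv_def cursor_inv_def cursor_def)

lemma bval_in_exchange:
  assumes "cursor_inv s i" "s ''k'' 0 < m"
  shows "bval in_exchange s \<longleftrightarrow>
    edge (s ''k'' 0) \<in> insert (edge (s ''f'' 0)) (family s i) - {edge (s ''e'' 0)}"
  using assms by (auto simp: in_exchange_def cursor_inv_def edge_in_family_iff edge_eq_iff)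

lemma bval_reduces_loads:
  assumes "cursor_inv s i" "family_inv s"
  shows "bval reduces_loads s \<longleftrightarrow> edge (s ''e'' 0) \<in> family s i \<and> (edge (s ''f'' 0) = edge (s ''e'' 0) \<or>
    load K (family s) (edge (s ''f'' 0)) + 2 \<le> load K (family s) (edge (s ''e'' 0)))"
  using assms
  by (auto simp: reduces_loads_def cursor_inv_def family_inv_def edge_in_family_iff edge_eq_iff)

lemma search_step_correct:
  assumes input: "reads_input s" and inv: "family_inv s" "scan_inv s"
    and cursor: "cursor_inv s i" "i < K"
    and connected: "n \<le> s ''count'' 0 \<longleftrightarrow>
      graph_connected {..<n} (insert (edge (s ''f'' 0)) (family s i) - {edge (s ''e'' 0)})"
  defines "s' \<equiv> effect search_step s"
  shows "(family_inv s' \<and> scan_inv s') \<and> search_measure s' < search_measure s"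
proof (cases "improving {..<n} K (family s) i (edge (s ''e'' 0)) (edge (s ''f'' 0))")
  case True
  then have result: "s' = effect exchange_step s"
    using connected reads_inputD(1)[OF input] bval_reduces_loads[OF cursor(1) inv(1)]
    by (simp add: s'_def search_step_def improving_def not_less)
  have restart: "s' ''base'' 0 = 0" "s' ''e'' 0 = 0" "s' ''f'' 0 = 0"
    by (simp_all add: result exchange_step_def)
  have inv': "family_inv s'"
    unfolding result by (rule family_inv_exchange_step[OF inv(1) cursor True])
  have less: "potential E K (family s') < potential E K (family s)"
    unfolding result by (rule potential_exchange_step_less[OF cursor True])
  have "search_measure s' < Suc (potential E K (family s')) * (num_positions + 1)"
    by (simp add: search_measure_def)
  also have "\<dots> \<le> potential E K (family s) * (num_positions + 1)"
    using less by (intro mult_le_mono1) simp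
  also have "\<dots> \<le> search_measure s" by (simp add: search_measure_def)
  finally show ?thesis using inv' scan_inv_start restart by simp
next
  case False
  then have result: "s' = effect advance_step s"
    using connected reads_inputD(1)[OF input] bval_reduces_loads[OF cursor(1) inv(1)]
    by (auto simp: s'_def search_step_def improving_def not_less)
  have arrays: "s' ''absent'' = s ''absent''" "s' ''load'' = s ''load''"
    by (simp_all add: result advance_step_def)
  have "family_inv s'"
    using inv(1) arrays family_cong[of s' s, OF arrays(1)] by (simp add: family_inv_def)
  moreover have "scan_inv s'"
    unfolding result
    by (rule scan_inv_advance_step[OF inv(2) cursor reads_inputD(2)[OF input] False])
  moreover have "search_measure s' < search_measure s"
    using advance_step_cursor[OF cursor reads_inputD(2)[OF input]]
      cursor_less_num_positions[OF cursor(1)] family_cong[of s' s, OF arrays(1)]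
    by (simp add: search_measure_def result[symmetric] diff_less_mono2)
  ultimately show ?thesis by simp
qed

lemma locally_optimal_if_scanned:
  assumes "family_inv s" "scan_inv s" "K * m \<le> s ''base'' 0"
  shows "locally_optimal {..<n} E K (family s)"
  unfolding locally_optimal_def
proof (intro conjI allI impI ballI)
  show "connected_family {..<n} E K (family s)" using assms(1) by (simp add: family_inv_def)
  fix i g h assume i_less: "i < K" and "g \<in> E" "h \<in> E"
  then obtain e f where indices: "e < m" "g = edge e" "f < m" "h = edge f" by (auto simp: edges_eq)
  have "K * m * m \<le> (s ''base'' 0 + s ''e'' 0) * m" using assms(3) by (intro mult_le_mono1) simp
  then have "position i e f < cursor s"
    using position_less[OF indices(1,3) i_less] unfolding cursor_def by linarith
  then show "\<not> improving {..<n} K (family s) i g h"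
    using assms(2) i_less indices by (simp add: scan_inv_def)
qed

end

definition search_time :: "nat \<Rightarrow> nat \<Rightarrow> nat" where
  "search_time n m = (m * (m ^ 3)\<^sup>2 * ((m ^ 3 * m + m) * m + 1) + (m ^ 3 * m + m) * m + 1) *
     (6 + (count_time in_exchange n m + ccost search_step))"

lemma written_search_step [simp]:
  "written search_step = {''load'', ''absent'', ''base'', ''e'', ''f''}"
  by (auto simp: search_step_def exchange_step_def advance_step_def)

lemma loop_free_search_step [simp]: "loop_free search_step"
  by (simp add: search_step_def exchange_step_def advance_step_def)

context input_graph
begin

lemma runs_search_round:
  assumes input: "reads_input s" and inv: "family_inv s" "scan_inv s"
    and base: "s ''base'' 0 < K * m"
  shows "runs (count_reachable in_exchange ;; search_step) s
    (count_time in_exchange n m + ccost search_step)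
    (\<lambda>s'. (family_inv s' \<and> scan_inv s') \<and> search_measure s' < search_measure s)"
proof -
  obtain i where cursor: "cursor_inv s i" using inv(2) by (auto simp: scan_inv_def)
  then have "i < K" using base by (simp add: cursor_inv_def)
  let ?A = "insert (edge (s ''f'' 0)) (family s i) - {edge (s ''e'' 0)}"
  show ?thesis
  proof (rule runs_Seq)
    show "runs (count_reachable in_exchange) s (count_time in_exchange n m)
        (\<lambda>s'. n \<le> s' ''count'' 0 \<longleftrightarrow> graph_connected {..<n} ?A)"
    proof (rule runs_count_reachable[OF input])
      show "bval in_exchange s' \<longleftrightarrow> edge (s' ''k'' 0) \<in> ?A"
        if outside: "equal_outside {''mark'', ''count'', ''k''} s s'"
          and k_less: "s' ''k'' 0 < m" for s'
      proof -
        have "s' ''e'' = s ''e''" "s' ''f'' = s ''f''" "family s' = family s" "cursor_inv s' i"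
          using equal_outsideD[OF outside] search_invs_outside[OF outside] cursor by simp_all
        then show ?thesis using bval_in_exchange[of s' i] k_less by simp
      qed
      show "?A \<subseteq> E" using family_subset cursor by (auto simp: cursor_inv_def edge_in_edges)
    qed
  next
    fix s' assume connected: "n \<le> s' ''count'' 0 \<longleftrightarrow> graph_connected {..<n} ?A"
      and "equal_outside (written (count_reachable in_exchange)) s s'"
    then have outside: "equal_outside {''mark'', ''count'', ''k''} s s'" by simp
    note invs = search_invs_outside[OF outside, simplified]
    have "s' ''e'' = s ''e''" "s' ''f'' = s ''f''" using equal_outsideD[OF outside] by simp_all
    then have "(family_inv (effect search_step s') \<and> scan_inv (effect search_step s')) \<and>
        search_measure (effect search_step s') < search_measure s'"
      using reads_input_outside[OF input outside] inv cursor \<open>i < K\<close> connected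
      by (intro search_step_correct[where i = i]) (simp_all add: invs)
    then show "runs search_step s' (ccost search_step)
        (\<lambda>s'. (family_inv s' \<and> scan_inv s') \<and> search_measure s' < search_measure s)"
      by (intro runs_loop_free) (simp_all add: invs)
  qed
qed

lemma search_measure_le: "search_measure s \<le> m * K\<^sup>2 * (num_positions + 1) + num_positions"
  unfolding search_measure_def using potential_le[of E K "family s"]
  by (intro add_mono mult_le_mono1) (simp_all add: card_edges)

lemma runs_search:
  assumes input: "reads_input s" and inv: "family_inv s" "scan_inv s"
    and cells: "s ''cells'' 0 = K * m"
  shows "runs search s (search_time n m)
    (\<lambda>s'. family_inv s' \<and> locally_optimal {..<n} E K (family s'))"
  unfolding search_def
proof (rule runs_mono[OF runs_While])
  let ?b = "Less (var ''base'') (var ''cells'')"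
    and ?c = "count_reachable in_exchange ;; search_step"
  let ?T = "count_time in_exchange n m + ccost search_step"
  let ?I = "\<lambda>s'. family_inv s' \<and> scan_inv s'"
  show "?I s" using inv ..
  have cells': "s' ''cells'' 0 = K * m" if "equal_outside (written ?c) s s'" for s'
    using equal_outsideD[OF that, of "''cells''"] cells by simp
  show "runs ?c s' ?T (\<lambda>s''. ?I s'' \<and> search_measure s'' < search_measure s')"
    if "?I s'" "equal_outside (written ?c) s s'" "bval ?b s'" for s'
    using that cells'[OF that(2)] reads_input_outside[OF input that(2)]
    by (intro runs_search_round) simp_all
  have "(search_measure s + 1) * (6 + ?T) \<le> search_time n m"
    unfolding search_time_def using search_measure_le[of s]
    by (intro mult_le_mono1) (simp add: K_def num_positions_def)
  moreover have "1 + bcost ?b + ?T = 6 + ?T" by simp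
  ultimately show "(search_measure s + 1) * (1 + bcost ?b + ?T) \<le> search_time n m" by metis
  show "family_inv s' \<and> locally_optimal {..<n} E K (family s')"
    if "?I s' \<and> \<not> bval ?b s'" "equal_outside (written (While ?b ?c)) s s'" for s'
    using that cells'[of s'] locally_optimal_if_scanned[of s'] by simp
qed

end

section \<open>Finding a gap and writing the output\<close>

definition min_load_step :: com where
  "min_load_step = Cond (Less (Cell ''load'' (var ''k'')) (var ''level''))
     (set_var ''level'' (Cell ''load'' (var ''k''))) Skip ;; incr ''k''"

definition raise_step :: com where
  "raise_step = Cond (eqb (Cell ''load'' (var ''k'')) (Add (var ''level'') (Lit 1)))
     (incr ''level'' ;; set_var ''k'' (Lit 0)) (incr ''k'')"

definition find_gap :: com where
  "find_gap = (set_var ''level'' (var ''K'') ;; scan ''m'' min_load_step) ;; scan ''m'' raise_step"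

definition output_step :: com where
  "output_step = Assign ''wden'' (var ''k'') (Lit 1) ;;
     Cond (Less (var ''level'') (Cell ''load'' (var ''k'')))
       (Assign ''wnum'' (var ''k'') (Lit 0))
       (Assign ''wnum'' (var ''k'') (Lit 1) ;; incr ''den'' ;;
        set_var ''num'' (Add (var ''num'') (Monus (Lit 1) (Cell ''absent'' (var ''k''))))) ;;
     incr ''k''"

definition write_output :: com where
  "write_output = (set_var ''num'' (Lit 0) ;; set_var ''den'' (Lit 0)) ;; scan ''m'' output_step"

definition find_gap_time :: "nat \<Rightarrow> nat" where
  "find_gap_time m = (4 + scan_time min_load_step m) + scan_time raise_step (m ^ 3 * (m + 1) + m)"

definition write_output_time :: "nat \<Rightarrow> nat" where
  "write_output_time m = 6 + scan_time output_step m"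

lemma written_find_gap [simp]: "written find_gap = {''level'', ''k''}"
  by (auto simp: find_gap_def min_load_step_def raise_step_def)

context input_graph
begin

lemma runs_min_load:
  assumes input: "reads_input s" and size: "s ''K'' 0 = K" and load: "\<And>k. k < m \<Longrightarrow> s ''load'' k \<le> K"
  shows "runs (set_var ''level'' (var ''K'') ;; scan ''m'' min_load_step) s
    (4 + scan_time min_load_step m)
    (\<lambda>s'. s' ''level'' 0 = Min (s ''load'' ` {..<m}))"
proof (rule runs_Seq)
  show "runs (set_var ''level'' (var ''K'')) s 4 (\<lambda>s'. s' ''level'' 0 = K)"
    by (rule runs_mono[OF runs_loop_free]) (use size in auto)
  fix s1 assume level: "s1 ''level'' 0 = K"
    and outside1: "equal_outside (written (set_var ''level'' (var ''K''))) s s1"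
  let ?P = "\<lambda>k s'. s' ''level'' 0 = Min (insert K (s ''load'' ` {..<k}))"
  have "runs (scan ''m'' min_load_step) s1 (scan_time min_load_step m) (?P m)"
  proof (rule runs_scan_once)
    show "s1 ''m'' 0 = m" using reads_inputD(2)[OF reads_input_outside[OF input outside1]] by simp
    show "?P (Suc k) (effect min_load_step s') \<and> effect min_load_step s' ''k'' 0 = Suc k"
      if invariant: "?P k s'" and k_eq: "s' ''k'' 0 = k"
        and outside': "equal_outside (written (scan ''m'' min_load_step)) s1 s'" for k s'
    proof -
      have "s' ''load'' = s ''load''"
        using equal_outsideD[OF outside'] equal_outsideD[OF outside1]
        by (simp add: min_load_step_def)
      then have "effect min_load_step s' ''level'' 0 = min (s ''load'' k) (s' ''level'' 0)"
        by (simp add: min_load_step_def k_eq)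
      then show ?thesis
        by (simp add: invariant k_eq min_load_step_def lessThan_Suc insert_commute[of K])
    qed
  qed (simp_all add: level min_load_step_def)
  moreover have "Min (s ''load'' ` {..<m}) \<le> K"
    by (rule order_trans[OF Min_le load[OF num_edges_pos]]) (use num_edges_pos in auto)
  then have "Min (insert K (s ''load'' ` {..<m})) = Min (s ''load'' ` {..<m})"
    using num_edges_pos by (subst Min_insert) (auto simp: min_absorb2)
  ultimately show "runs (scan ''m'' min_load_step) s1 (scan_time min_load_step m)
      (\<lambda>s'. s' ''level'' 0 = Min (s ''load'' ` {..<m}))" by simp
qed

lemma runs_raise:
  assumes input: "reads_input s" and level: "s ''level'' 0 \<in> s ''load'' ` {..<m}"
    and load: "\<And>k. k < m \<Longrightarrow> s ''load'' k \<le> K"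
  shows "runs (scan ''m'' raise_step) s (scan_time raise_step (m ^ 3 * (m + 1) + m))
    (\<lambda>s'. {s ''level'' 0..s' ''level'' 0} \<subseteq> s ''load'' ` {..<m} \<and> s ''level'' 0 \<le> s' ''level'' 0 \<and>
      Suc (s' ''level'' 0) \<notin> s ''load'' ` {..<m})"
  unfolding K_def[symmetric]
proof (rule runs_mono[OF runs_scan_restart[where progress = "\<lambda>s'. s' ''level'' 0"] order_refl])
  let ?raised = "\<lambda>h. {s ''level'' 0..h} \<subseteq> s ''load'' ` {..<m} \<and> s ''level'' 0 \<le> h"
  let ?I = "\<lambda>s'. ?raised (s' ''level'' 0) \<and> (\<forall>l<s' ''k'' 0. s ''load'' l \<noteq> Suc (s' ''level'' 0))"
  show "?I (s(''k'' := (s ''k'')(0 := 0)))" using level by simp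
  let ?next = "effect raise_step"
  show "?I (?next s') \<and>
      (?next s' ''level'' 0 = s' ''level'' 0 \<and> ?next s' ''k'' 0 = Suc (s' ''k'' 0) \<or>
       s' ''level'' 0 < ?next s' ''level'' 0 \<and> ?next s' ''level'' 0 \<le> K)"
    if invariant: "?I s'" and outside: "equal_outside (written (scan ''m'' raise_step)) s s'"
      and k_less: "s' ''k'' 0 < m" for s'
  proof -
    have load': "s' ''load'' = s ''load''"
      using equal_outsideD[OF outside] by (simp add: raise_step_def)
    show ?thesis
    proof (cases "s ''load'' (s' ''k'' 0) = Suc (s' ''level'' 0)")
      case True
      have "Suc (s' ''level'' 0) \<in> s ''load'' ` {..<m}" using k_less by (simp add: True[symmetric])
      then have "?raised (Suc (s' ''level'' 0))"
        using invariant by (auto simp: atLeastAtMostSuc_conv)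
      moreover have "Suc (s' ''level'' 0) \<le> K" using load[OF k_less] True by simp
      ultimately show ?thesis using True by (simp add: raise_step_def load')
    next
      case False
      then show ?thesis using invariant by (simp add: raise_step_def load' less_Suc_eq)
    qed
  qed
  show "{s ''level'' 0..s' ''level'' 0} \<subseteq> s ''load'' ` {..<m} \<and> s ''level'' 0 \<le> s' ''level'' 0 \<and>
      Suc (s' ''level'' 0) \<notin> s ''load'' ` {..<m}" if "?I s' \<and> m \<le> s' ''k'' 0" for s'
  proof -
    have "\<forall>l<m. Suc (s' ''level'' 0) \<noteq> s ''load'' l" using that by (metis less_le_trans)
    then show ?thesis using that by auto
  qed
qed (use reads_inputD(2)[OF input] in \<open>simp_all add: raise_step_def\<close>)

lemma load_gap_if_raised:
  assumes inv: "family_inv s" and raised: "Min (s ''load'' ` {..<m}) \<le> h"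
    "{Min (s ''load'' ` {..<m})..h} \<subseteq> s ''load'' ` {..<m}" "Suc h \<notin> s ''load'' ` {..<m}"
  shows "load_gap E (load K (family s)) h"
proof -
  have "load K (family s) ` E = s ''load'' ` {..<m}"
    unfolding edges_eq image_image using inv by (intro image_cong) (simp_all add: family_inv_def)
  then show ?thesis
    using raised interval_subset_image_less[OF finite_edges nonempty, of _ h "load K (family s)"]
    by (simp add: load_gap_def)
qed

lemma runs_find_gap:
  assumes input: "reads_input s" and inv: "family_inv s" and size: "s ''K'' 0 = K"
  shows "runs find_gap s (find_gap_time m) (\<lambda>s'. load_gap E (load K (family s)) (s' ''level'' 0))"
  unfolding find_gap_def find_gap_time_def
proof (rule runs_Seq[OF runs_min_load[OF input size]])
  let ?loads = "s ''load'' ` {..<m}"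
  show load_le_K: "s ''load'' k \<le> K" if "k < m" for k
    using that inv load_le[of K "family s" "edge k"] by (simp add: family_inv_def)
  fix s1 assume level: "s1 ''level'' 0 = Min ?loads"
    and "equal_outside (written (set_var ''level'' (var ''K'') ;; scan ''m'' min_load_step)) s s1"
  then have outside: "equal_outside {''level'', ''k''} s s1"
    by (simp add: equal_outside_def min_load_step_def)
  then have load: "s1 ''load'' = s ''load''" by (simp add: equal_outside_def)
  show "runs (scan ''m'' raise_step) s1 (scan_time raise_step (m ^ 3 * (m + 1) + m))
      (\<lambda>s'. load_gap E (load K (family s)) (s' ''level'' 0))"
  proof (rule runs_mono[OF runs_raise order_refl])
    show "reads_input s1" using reads_input_outside[OF input outside] by simp
    have "Min ?loads \<in> ?loads" using num_edges_pos by (intro Min_in) auto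
    then show "s1 ''level'' 0 \<in> s1 ''load'' ` {..<m}" by (simp add: level load)
    show "s1 ''load'' k \<le> K" if "k < m" for k using load_le_K[OF that] by (simp add: load)
    show "load_gap E (load K (family s)) (s' ''level'' 0)"
      if "{s1 ''level'' 0..s' ''level'' 0} \<subseteq> s1 ''load'' ` {..<m} \<and> s1 ''level'' 0 \<le> s' ''level'' 0 \<and>
        Suc (s' ''level'' 0) \<notin> s1 ''load'' ` {..<m}" for s'
      using that load_gap_if_raised[OF inv] by (simp add: level load)
  qed
qed

lemma card_less_Suc_Collect: "card {l. l < Suc k \<and> P l} = card {l. l < k \<and> P l} + of_bool (P k)"
proof -
  have "{l. l < Suc k \<and> P l} = (if P k then insert k {l. l < k \<and> P l} else {l. l < k \<and> P l})"
    by (auto simp: less_Suc_eq)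
  then show ?thesis by simp
qed

lemma runs_write_output:
  assumes input: "reads_input s" and absent: "\<And>q. s ''absent'' q \<le> 1"
  shows "runs write_output s (write_output_time m) (\<lambda>s'.
    s' ''den'' 0 = card {k. k < m \<and> s ''load'' k \<le> s ''level'' 0} \<and>
    s' ''num'' 0 = card {k. k < m \<and> s ''load'' k \<le> s ''level'' 0 \<and> s ''absent'' k = 0} \<and>
    (\<forall>k<m. s' ''wden'' k = 1 \<and> s' ''wnum'' k = of_bool (s ''load'' k \<le> s ''level'' 0)))"
  unfolding write_output_def write_output_time_def
proof (rule runs_Seq)
  let ?init = "set_var ''num'' (Lit 0) ;; set_var ''den'' (Lit 0)"
  show "runs ?init s 6 (\<lambda>s'. s' ''num'' 0 = 0 \<and> s' ''den'' 0 = 0)"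
    by (rule runs_mono[OF runs_loop_free]) auto
  fix s1 assume zero: "s1 ''num'' 0 = 0 \<and> s1 ''den'' 0 = 0"
    and outside: "equal_outside (written ?init) s s1"
  let ?P = "\<lambda>k s'. s' ''den'' 0 = card {l. l < k \<and> s ''load'' l \<le> s ''level'' 0} \<and>
    s' ''num'' 0 = card {l. l < k \<and> s ''load'' l \<le> s ''level'' 0 \<and> s ''absent'' l = 0} \<and>
    (\<forall>l<k. s' ''wden'' l = 1 \<and> s' ''wnum'' l = of_bool (s ''load'' l \<le> s ''level'' 0))"
  show "runs (scan ''m'' output_step) s1 (scan_time output_step m) (?P m)"
  proof (rule runs_scan_once)
    show "s1 ''m'' 0 = m" using reads_inputD(2)[OF reads_input_outside[OF input outside]] by simp
    show "?P 0 (s1(''k'' := (s1 ''k'')(0 := 0)))" using zero by simp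
    fix k s'
    assume invariant: "?P k s'" and k_eq: "s' ''k'' 0 = k"
      and outside': "equal_outside (written (scan ''m'' output_step)) s1 s'"
    let ?light = "s ''load'' k \<le> s ''level'' 0" and ?s = "effect output_step s'"
    have "s' ''load'' = s ''load''" "s' ''absent'' = s ''absent''" "s' ''level'' = s ''level''"
      using equal_outsideD[OF outside'] equal_outsideD[OF outside]
      by (simp_all add: output_step_def)
    moreover have "1 - s ''absent'' k = of_bool (s ''absent'' k = 0)" using absent[of k] by auto
    ultimately have "?s ''den'' 0 = s' ''den'' 0 + of_bool ?light"
      "?s ''num'' 0 = s' ''num'' 0 + of_bool (?light \<and> s ''absent'' k = 0)"
      "?s ''wden'' = (s' ''wden'')(k := 1)" "?s ''wnum'' = (s' ''wnum'')(k := of_bool ?light)"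
      "?s ''k'' 0 = Suc k"
      using k_eq by (auto simp: output_step_def)
    then show "?P (Suc k) ?s \<and> ?s ''k'' 0 = Suc k"
      using invariant by (simp add: card_less_Suc_Collect All_less_Suc)
  qed (simp_all add: output_step_def)
qed

lemma solves_min_weighting_ratioI:
  assumes inv: "family_inv s" and optimal: "locally_optimal {..<n} E K (family s)"
    and gap: "load_gap E (load K (family s)) h"
    and den: "s' ''den'' 0 = card {k. k < m \<and> s ''load'' k \<le> h}"
    and num: "s' ''num'' 0 = card {k. k < m \<and> s ''load'' k \<le> h \<and> s ''absent'' k = 0}"
    and weights: "\<And>k. k < m \<Longrightarrow> s' ''wden'' k = 1 \<and> s' ''wnum'' k = of_bool (s ''load'' k \<le> h)"
  shows "solves_min_weighting_ratio {..<n} E es s'"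
proof -
  let ?L = "light_edges E K (family s) h"
  have light: "edge k \<in> ?L \<longleftrightarrow> s ''load'' k \<le> h" if "k < m" for k
    using inv that edge_in_edges[OF that] by (simp add: light_edges_def family_inv_def)
  have card_image: "card (edge ` {k. k < m \<and> P k}) = card {k. k < m \<and> P k}" for P
    by (rule card_image[OF inj_on_subset[OF inj_on_edge]]) auto
  have "?L = edge ` {k. k < m \<and> s ''load'' k \<le> h}"
    by (rule subsets_eqI) (auto simp: light light_edges_subset edge_in_edges edge_eq_iff)
  then have card_L: "card ?L = s' ''den'' 0" by (simp only: card_image den)
  have "family s 0 \<inter> ?L = edge ` {k. k < m \<and> s ''load'' k \<le> h \<and> s ''absent'' k = 0}"
    by (rule subsets_eqI)
      (use family_subset in \<open>auto simp: light edge_in_family_iff edge_in_edges edge_eq_iff\<close>)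
  then have card_Int: "card (family s 0 \<inter> ?L) = s' ''num'' 0" by (simp only: card_image num)
  have "0 < K" using num_edges_pos by (simp add: K_def)
  have attained: "weighting_ratio {..<n} E (indicator ?L) = min_weighting_ratio {..<n} E"
    by (rule light_edges_optimal[OF optimal gap]) (simp add: card_edges K_def)
  have light_set: "?L \<subseteq> E" "?L \<noteq> {}" by (rule light_edges_subset, rule light_edges_nonempty[OF gap])
  then have "0 < s' ''den'' 0"
    using finite_subset[OF _ finite_edges] by (simp add: card_L[symmetric] card_gt_0_iff)
  moreover have "real (s' ''num'' 0) / real (s' ''den'' 0) = min_weighting_ratio {..<n} E"
    using light_edges_ratio[OF optimal gap \<open>0 < K\<close>] by (simp add: attained card_Int card_L)
  moreover have "indicator ?L (edge k) = real (s' ''wnum'' k) / real (s' ''wden'' k)" if "k < m"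
    for k
    using weights[OF that] light[OF that] by (simp add: indicator_def)
  then have "\<forall>k<m. s' ''wden'' k > 0 \<and>
      indicator ?L {src k, dst k} = real (s' ''wnum'' k) / real (s' ''wden'' k)"
    using weights by (simp add: edge_def)
  ultimately show ?thesis
    unfolding solves_min_weighting_ratio_def
    using attained indicator_in_weightings[OF light_set] by blast
qed

end

section \<open>The program\<close>

definition init_step :: com where
  "init_step = Assign ''load'' (var ''k'') (var ''K'') ;; incr ''k''"

definition compute_sizes :: com where
  "compute_sizes =
     multiply ''m'' ''m'' ''square'' ;;
     multiply ''square'' ''m'' ''K'' ;;
     multiply ''K'' ''m'' ''cells''"

definition solve :: com where
  "solve = (compute_sizes ;; scan ''m'' init_step) ;; search ;; find_gap ;; write_output"

definition compute_sizes_time :: "nat \<Rightarrow> nat" where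
  "compute_sizes_time m = multiply_time m + (multiply_time (m * m) + multiply_time (m ^ 3))"

definition solve_time :: "nat \<Rightarrow> nat \<Rightarrow> nat" where
  "solve_time n m = (compute_sizes_time m + scan_time init_step m) +
     (search_time n m + (find_gap_time m + write_output_time m))"

lemma written_compute_sizes [simp]: "written compute_sizes = {''square'', ''K'', ''cells'', ''k''}"
  by (auto simp: compute_sizes_def)

lemma written_search [simp]:
  "written search = {''mark'', ''count'', ''k'', ''load'', ''absent'', ''base'', ''e'', ''f''}"
  by (auto simp: search_def)

lemma runs_compute_sizes:
  assumes num_edges: "s ''m'' 0 = m"
  shows "runs compute_sizes s (compute_sizes_time m)
    (\<lambda>s'. s' ''K'' 0 = m ^ 3 \<and> s' ''cells'' 0 = m ^ 3 * m)"
  unfolding compute_sizes_def compute_sizes_time_def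
proof (rule runs_Seq)
  show "runs (multiply ''m'' ''m'' ''square'') s (multiply_time m) (\<lambda>s'. s' ''square'' 0 = m * m)"
    using runs_multiply[of "''m''" "''square''" "''m''" s] num_edges by simp
  fix s1 assume square: "s1 ''square'' 0 = m * m"
    and "equal_outside (written (multiply ''m'' ''m'' ''square'')) s s1"
  then have num_edges1: "s1 ''m'' 0 = m" using num_edges by (simp add: equal_outside_def)
  show "runs (multiply ''square'' ''m'' ''K'' ;; multiply ''K'' ''m'' ''cells'') s1
      (multiply_time (m * m) + multiply_time (m ^ 3))
      (\<lambda>s'. s' ''K'' 0 = m ^ 3 \<and> s' ''cells'' 0 = m ^ 3 * m)"
  proof (rule runs_Seq)
    show "runs (multiply ''square'' ''m'' ''K'') s1 (multiply_time (m * m)) (\<lambda>s'. s' ''K'' 0 = m ^ 3)"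
      using runs_multiply[of "''square''" "''K''" "''m''" s1] square num_edges1
      by (simp add: power3_eq_cube)
    fix s2 assume cube: "s2 ''K'' 0 = m ^ 3"
      and "equal_outside (written (multiply ''square'' ''m'' ''K'')) s1 s2"
    then have "s2 ''m'' 0 = m" using num_edges1 by (simp add: equal_outside_def)
    then have "runs (multiply ''K'' ''m'' ''cells'') s2 (multiply_time (m ^ 3))
        (\<lambda>s'. s' ''cells'' 0 = m ^ 3 * m)"
      using runs_multiply[of "''K''" "''cells''" "''m''" s2] cube by simp
    then show "runs (multiply ''K'' ''m'' ''cells'') s2 (multiply_time (m ^ 3))
        (\<lambda>s'. s' ''K'' 0 = m ^ 3 \<and> s' ''cells'' 0 = m ^ 3 * m)"
      by (rule runs_mono) (use cube in \<open>simp_all add: equal_outside_def\<close>)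
  qed
qed

context input_graph
begin

lemma runs_init_loads:
  assumes "s ''m'' 0 = m" "s ''K'' 0 = K"
  shows "runs (scan ''m'' init_step) s (scan_time init_step m) (\<lambda>s'. \<forall>k<m. s' ''load'' k = K)"
  by (rule runs_scan_once[where P = "\<lambda>k s'. \<forall>l<k. s' ''load'' l = K"])
    (use assms in \<open>auto simp: init_step_def equal_outside_def less_Suc_eq\<close>)

lemma initial_invs:
  assumes "s ''absent'' = (\<lambda>_. 0)" "s ''base'' 0 = 0" "s ''e'' 0 = 0" "s ''f'' 0 = 0"
    and "\<And>k. k < m \<Longrightarrow> s ''load'' k = K"
  shows "family_inv s" "scan_inv s"
proof -
  have "family s = (\<lambda>_. E)"
    using assms(1) by (simp add: fun_eq_iff family_def edges_eq lessThan_def)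
  then show "family_inv s"
    using assms connected by (simp add: family_inv_def connected_family_def load_def edge_in_edges)
  show "scan_inv s" using assms by (intro scan_inv_start)
qed

definition search_ready :: "state \<Rightarrow> bool" where
  "search_ready s \<longleftrightarrow> reads_input s \<and> family_inv s \<and> scan_inv s \<and>
     s ''K'' 0 = K \<and> s ''cells'' 0 = K * m"

lemma runs_prepare:
  "runs (compute_sizes ;; scan ''m'' init_step) (input_state n es)
     (compute_sizes_time m + scan_time init_step m) search_ready"
proof (rule runs_Seq)
  let ?s = "input_state n es"
  have "reads_input ?s" by (simp add: reads_input_def equal_outside_refl)
  note input = reads_inputD(2)[OF this] reads_input_outside[OF this]
  show "runs compute_sizes ?s (compute_sizes_time m) (\<lambda>s. s ''K'' 0 = K \<and> s ''cells'' 0 = K * m)"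
    unfolding K_def by (rule runs_compute_sizes) (rule input)
  fix s1 assume sizes: "s1 ''K'' 0 = K \<and> s1 ''cells'' 0 = K * m"
    and outside: "equal_outside (written compute_sizes) ?s s1"
  have "s1 ''m'' 0 = m" using equal_outsideD[OF outside] input(1) by simp
  then show "runs (scan ''m'' init_step) s1 (scan_time init_step m) search_ready"
  proof (rule runs_mono[OF runs_init_loads order_refl])
    fix s2 assume loads: "\<forall>k<m. s2 ''load'' k = K"
      and outside2: "equal_outside (written (scan ''m'' init_step)) s1 s2"
    have outside': "equal_outside {''square'', ''K'', ''cells'', ''k'', ''load''} ?s s2"
      using outside outside2 by (auto simp: equal_outside_def init_step_def)
    have "reads_input s2" by (rule input(2)[OF outside']) simp
    moreover have "s2 ''absent'' = (\<lambda>_. 0)" "s2 ''base'' 0 = 0" "s2 ''e'' 0 = 0" "s2 ''f'' 0 = 0"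
      by (simp_all add: equal_outsideD[OF outside'] input_state_def fun_eq_iff)
    then have "family_inv s2" "scan_inv s2" using loads initial_invs[of s2] by simp_all
    moreover have "s2 ''K'' 0 = K" "s2 ''cells'' 0 = K * m"
      using sizes equal_outsideD[OF outside2] by (simp_all add: init_step_def)
    ultimately show "search_ready s2" by (simp add: search_ready_def)
  qed (use sizes in simp)
qed

lemma runs_solve:
  "runs solve (input_state n es) (solve_time n m) (solves_min_weighting_ratio {..<n} E es)"
  unfolding solve_def solve_time_def
proof (rule runs_Seq[OF runs_prepare])
  fix s1 assume prepared: "search_ready s1"
  show "runs (search ;; find_gap ;; write_output) s1
      (search_time n m + (find_gap_time m + write_output_time m))
      (solves_min_weighting_ratio {..<n} E es)"
  proof (rule runs_Seq)
    show "runs search s1 (search_time n m) (\<lambda>s. family_inv s \<and> locally_optimal {..<n} E K (family s))"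
      using prepared by (intro runs_search) (simp_all add: search_ready_def)
    fix s2 assume searched: "family_inv s2 \<and> locally_optimal {..<n} E K (family s2)"
      and outside2: "equal_outside (written search) s1 s2"
    have input2: "reads_input s2"
      using reads_input_outside[OF _ outside2] prepared by (simp add: search_ready_def)
    have "s2 ''K'' 0 = K"
      using equal_outsideD[OF outside2] prepared by (simp add: search_ready_def)
    then show "runs (find_gap ;; write_output) s2 (find_gap_time m + write_output_time m)
        (solves_min_weighting_ratio {..<n} E es)"
    proof (intro runs_Seq[OF runs_find_gap[OF input2]])
      show "family_inv s2" using searched ..
      fix s3 assume gap: "load_gap E (load K (family s2)) (s3 ''level'' 0)"
        and outside3: "equal_outside (written find_gap) s2 s3"
      have arrays: "s3 ''load'' = s2 ''load''" "s3 ''absent'' = s2 ''absent''"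
        using equal_outsideD[OF outside3] by simp_all
      show "runs write_output s3 (write_output_time m) (solves_min_weighting_ratio {..<n} E es)"
      proof (rule runs_mono[OF runs_write_output order_refl])
        show "reads_input s3" using reads_input_outside[OF input2 outside3] by simp
        show "s3 ''absent'' q \<le> 1" for q using searched by (simp add: arrays family_inv_def)
      qed (use searched gap in \<open>auto simp: arrays
            intro!: solves_min_weighting_ratioI[of s2 "s3 ''level'' 0"]\<close>)
    qed
  qed
qed

end

section \<open>Polynomial bounds\<close>

definition poly_bounded :: "(nat \<Rightarrow> nat) \<Rightarrow> bool" where
  "poly_bounded f \<longleftrightarrow> (\<exists>p. \<forall>n. f n \<le> poly p n)"

lemma poly_bounded_const: "poly_bounded (\<lambda>n. c)"
  unfolding poly_bounded_def by (rule exI[of _ "[:c:]"]) simp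

lemma poly_bounded_ident: "poly_bounded (\<lambda>n. n)"
  unfolding poly_bounded_def by (rule exI[of _ "[:0, 1:]"]) simp

lemma poly_bounded_add:
  assumes "poly_bounded f" "poly_bounded g"
  shows "poly_bounded (\<lambda>n. f n + g n)"
proof -
  obtain p q where "\<And>n. f n \<le> poly p n" "\<And>n. g n \<le> poly q n"
    using assms by (auto simp: poly_bounded_def)
  then show ?thesis unfolding poly_bounded_def by (intro exI[of _ "p + q"]) (simp add: add_mono)
qed

lemma poly_bounded_mult:
  assumes "poly_bounded f" "poly_bounded g"
  shows "poly_bounded (\<lambda>n. f n * g n)"
proof -
  obtain p q where "\<And>n. f n \<le> poly p n" "\<And>n. g n \<le> poly q n"
    using assms by (auto simp: poly_bounded_def)
  then show ?thesis unfolding poly_bounded_def by (intro exI[of _ "p * q"]) (simp add: mult_le_mono)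
qed

lemma poly_bounded_power: "poly_bounded f \<Longrightarrow> poly_bounded (\<lambda>n. f n ^ k)"
  by (induction k) (simp_all add: poly_bounded_const poly_bounded_mult)

lemmas time_defs = solve_time_def compute_sizes_time_def search_time_def find_gap_time_def
  write_output_time_def count_time_def multiply_time_def scan_time_def

lemma poly_bounded_solve_time: "poly_bounded (\<lambda>n. solve_time n (n * n))"
  unfolding time_defs
  by (intro poly_bounded_const poly_bounded_ident poly_bounded_add poly_bounded_mult
      poly_bounded_power)

lemma solve_time_mono: "m \<le> m' \<Longrightarrow> solve_time n m \<le> solve_time n m'"
  unfolding time_defs by (intro add_mono mult_mono power_mono order_refl) simp_all

theorem theorem2:
  "\<exists>(c :: com) (p :: nat poly). \<forall>(n :: nat) (E :: nat set set) (es :: (nat \<times> nat) list).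
     simple_graph {..<n} E \<and> graph_connected {..<n} E \<and> E \<noteq> {} \<and> edge_listing es E \<longrightarrow>
     (\<exists>t s'. exec c (input_state n es) t s' \<and> t \<le> poly p n \<and>
        solves_min_weighting_ratio {..<n} E es s')"
proof -
  obtain p where bound: "\<And>n. solve_time n (n * n) \<le> poly p n"
    using poly_bounded_solve_time by (auto simp: poly_bounded_def)
  have "runs solve (input_state n es) (poly p n) (solves_min_weighting_ratio {..<n} E es)"
    if "simple_graph {..<n} E" "graph_connected {..<n} E" "E \<noteq> {}" "edge_listing es E" for n E es
  proof -
    interpret input_graph n E es using that by unfold_locales
    have "solve_time n m \<le> poly p n" using solve_time_mono[OF num_edges_le] bound le_trans by blast
    with runs_solve show ?thesis by (rule runs_mono)
  qed
  then show ?thesis unfolding runs_def by blast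
qed

end
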